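(* Fix a locality range $\ell\ge 2$. There exists a constant $c>0$ (independent of the number of qubits and of the states) such that for every $n\ge 2$ and all pure states $\rho_0,\rho_1$ of an $n$-qubit chain, Nielsen's quantum circuit complexity $\mathcal{C}_{\mathcal{N}}(\rho_0\to\rho_1)$ for transforming $\rho_0$ into $\rho_1$ with a circuit that is geometrically local (of range $\ell$) with respect to the chain satisfies $$\mathcal{C}_{\mathcal{N}}(\rho_0\to\rho_1)\;\ge\;\frac{c}{n-1}\sum_{k=1}^{n-1}\bigl|S_k(\rho_1)-S_k(\rho_0)\bigr|,$$ where $S_k(\rho)$ denotes the entanglement entropy of $\rho$ across the cut $k$.
   Context: The qubits are labelled $1,2,\dots,n$ along a chain. A pure state is a rank-one projection on $(\mathbb{C}^2)^{\otimes n}$. Entanglement entropy. For $k\in\{1,\dots,n-1\}$ let $A_k=\{1,\dots,k\}$, $B_k=\{k+1,\dots,n\}$, and let $\rho(A_k)=\mathrm{tr}_{B_k}\rho$ be the reduced density matrix. Then $S_k(\rho)=-\mathrm{tr}[\rho(A_k)\ln\rho(A_k)]$. Nielsen's quantum circuit complexity with geometrically local circuits. Let $P_n=\{I,X,Y,Z\}^{\otimes n}$ be the $n$-qubit Pauli operators ($I$ the $2\times2$ identity, $X,Y,Z$ the Pauli matrices). Geometric locality of range $\ell$ means that the generator only involves Pauli operators $\sigma\in P_n$ whose support (the set of qubits on which $\sigma$ acts as a non-identity Pauli matrix) is contained in a set of at most $\ell$ consecutive qubits of the chain. An admissible path from $\rho_0$ to $\rho_1$ is given by real-valued smooth functions $h=(h_\sigma)$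 on $[0,1]$, with $h_\sigma\equiv 0$ for $\sigma=I^{\otimes n}$ and for every $\sigma$ that is not geometrically local, such that, with $G(s)=\sum_{\sigma}h_\sigma(s)\,\sigma$ and $U(s)$ the solution of $\partial_sU(s)=-iG(s)U(s)$, $U(0)=\mathrm{Id}$, one has $U(1)\rho_0U(1)^\dagger=\rho_1$. Then $$\mathcal{C}_{\mathcal{N}}(\rho_0\to\rho_1)=\inf_{h}\int_0^1\sum_{\sigma}|h_\sigma(s)|\,ds,$$ the infimum being over all admissible paths. *)

theory Defs
  imports
    "HOL-Analysis.Analysis"
    "Jordan_Normal_Form.Matrix"
    "Jordan_Normal_Form.DL_Rank"
    "Jordan_Normal_Form.Schur_Decomposition"
begin

section \<open>Matrices\<close>

definition matrix_trace :: "complex mat \<Rightarrow> complex" where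
  "matrix_trace A = (\<Sum>i<dim_row A. A $$ (i, i))"

definition unitary :: "nat \<Rightarrow> complex mat \<Rightarrow> bool" where
  "unitary d U \<longleftrightarrow> U \<in> carrier_mat d d \<and> mat_adjoint U * U = 1\<^sub>m d \<and> U * mat_adjoint U = 1\<^sub>m d"

text \<open>Functional calculus for Hermitian matrices by unitary diagonalisation. Lemma
  \<open>herm_fun_eq\<close> below shows that the result does not depend on the diagonalisation.\<close>

definition herm_fun :: "(real \<Rightarrow> real) \<Rightarrow> complex mat \<Rightarrow> complex mat" where
  "herm_fun f A = (THE B. \<exists>U e. unitary (dim_row A) U
      \<and> A = U * mat_diag (dim_row A) (\<lambda>i. complex_of_real (e i)) * mat_adjoint U
      \<and> B = U * mat_diag (dim_row A) (\<lambda>i. complex_of_real (f (e i))) * mat_adjoint U)"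

definition kronecker :: "complex mat \<Rightarrow> complex mat \<Rightarrow> complex mat" where
  "kronecker A B = Matrix.mat (dim_row A * dim_row B) (dim_col A * dim_col B)
     (\<lambda>(i, j). A $$ (i div dim_row B, j div dim_col B) * B $$ (i mod dim_row B, j mod dim_col B))"


section \<open>States of a chain of qubits and entanglement entropy\<close>

text \<open>Operators on the chain with qubits \<open>1, \<dots>, n\<close> are \<open>2 ^ n \<times> 2 ^ n\<close> matrices. Basis
  vectors are numbered by the binary expansion, with qubit 1 as most significant digit, in
  accordance with the Kronecker product.\<close>

definition pure_state :: "nat \<Rightarrow> complex mat \<Rightarrow> bool" where
  "pure_state n \<rho> \<longleftrightarrow> \<rho> \<in> carrier_mat (2 ^ n) (2 ^ n)
     \<and> mat_adjoint \<rho> = \<rho> \<and> \<rho> * \<rho> = \<rho> \<and> vec_space.rank (2 ^ n) \<rho> = 1"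

text \<open>The partial trace over the qubits \<open>k + 1, \<dots>, n\<close>.\<close>

definition reduced_state :: "nat \<Rightarrow> nat \<Rightarrow> complex mat \<Rightarrow> complex mat" where
  "reduced_state n k \<rho> = Matrix.mat (2 ^ k) (2 ^ k)
     (\<lambda>(i, j). \<Sum>b<2 ^ (n - k). \<rho> $$ (i * 2 ^ (n - k) + b, j * 2 ^ (n - k) + b))"

text \<open>The trace below is real for Hermitian \<open>\<rho>\<close>; \<open>Re\<close> only changes the type. Zero
  eigenvalues contribute 0 because \<open>0 * ln 0 = 0\<close>.\<close>

definition entanglement_entropy :: "nat \<Rightarrow> nat \<Rightarrow> complex mat \<Rightarrow> real" where
  "entanglement_entropy n k \<rho> =
     - Re (matrix_trace (reduced_state n k \<rho> * herm_fun ln (reduced_state n k \<rho>)))"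


section \<open>Pauli operators\<close>

datatype pauli = PI | PX | PY | PZ

fun pauli_matrix :: "pauli \<Rightarrow> complex mat" where
  "pauli_matrix PI = mat_of_rows_list 2 [[1, 0], [0, 1]]"
| "pauli_matrix PX = mat_of_rows_list 2 [[0, 1], [1, 0]]"
| "pauli_matrix PY = mat_of_rows_list 2 [[0, - \<i>], [\<i>, 0]]"
| "pauli_matrix PZ = mat_of_rows_list 2 [[1, 0], [0, - 1]]"

definition pauli_strings :: "nat \<Rightarrow> pauli list set" where
  "pauli_strings n = {\<sigma>. length \<sigma> = n}"

fun pauli_operator :: "pauli list \<Rightarrow> complex mat" where
  "pauli_operator [] = 1\<^sub>m 1"
| "pauli_operator (p # \<sigma>) = kronecker (pauli_matrix p) (pauli_operator \<sigma>)"

definition pauli_support :: "pauli list \<Rightarrow> nat set" where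
  "pauli_support \<sigma> = {q \<in> {1..length \<sigma>}. \<sigma> ! (q - 1) \<noteq> PI}"

definition geometrically_local :: "nat \<Rightarrow> pauli list \<Rightarrow> bool" where
  "geometrically_local l \<sigma> \<longleftrightarrow>
     (\<exists>a b. {a..b} \<subseteq> {1..length \<sigma>} \<and> card {a..b} \<le> l \<and> pauli_support \<sigma> \<subseteq> {a..b})"


section \<open>Nielsen complexity\<close>

text \<open>Smoothness on \<open>[0, 1]\<close>, with one-sided derivatives at the end points; \<open>D k\<close> is the
  derivative of order \<open>k\<close>.\<close>

definition smooth_on_unit_interval :: "(real \<Rightarrow> real) \<Rightarrow> bool" where
  "smooth_on_unit_interval f \<longleftrightarrow> (\<exists>D :: nat \<Rightarrow> real \<Rightarrow> real.
     (\<forall>s\<in>{0..1}. D 0 s = f s) \<and>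
     (\<forall>k. \<forall>s\<in>{0..1}. (D k has_real_derivative D (Suc k) s) (at s within {0..1})))"

definition generator :: "nat \<Rightarrow> (pauli list \<Rightarrow> real \<Rightarrow> real) \<Rightarrow> real \<Rightarrow> complex mat" where
  "generator n h s = Matrix.mat (2 ^ n) (2 ^ n)
     (\<lambda>(i, j). \<Sum>\<sigma>\<in>pauli_strings n. complex_of_real (h \<sigma> s) * pauli_operator \<sigma> $$ (i, j))"

definition propagator ::
    "nat \<Rightarrow> (pauli list \<Rightarrow> real \<Rightarrow> real) \<Rightarrow> (real \<Rightarrow> complex mat) \<Rightarrow> bool" where
  "propagator n h U \<longleftrightarrow>
     (\<forall>s\<in>{0..1}. U s \<in> carrier_mat (2 ^ n) (2 ^ n)) \<and> U 0 = 1\<^sub>m (2 ^ n) \<and>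
     (\<forall>s\<in>{0..1}. \<forall>i<2 ^ n. \<forall>j<2 ^ n.
        ((\<lambda>t. U t $$ (i, j)) has_vector_derivative ((- \<i>) \<cdot>\<^sub>m (generator n h s * U s)) $$ (i, j))
          (at s within {0..1}))"

definition admissible_path ::
    "nat \<Rightarrow> nat \<Rightarrow> complex mat \<Rightarrow> complex mat \<Rightarrow> (pauli list \<Rightarrow> real \<Rightarrow> real) \<Rightarrow> bool" where
  "admissible_path l n \<rho>\<^sub>0 \<rho>\<^sub>1 h \<longleftrightarrow>
     (\<forall>\<sigma>\<in>pauli_strings n. smooth_on_unit_interval (h \<sigma>)) \<and>
     (\<forall>\<sigma>\<in>pauli_strings n. \<sigma> = replicate n PI \<or> \<not> geometrically_local l \<sigma>
        \<longrightarrow> (\<forall>s\<in>{0..1}. h \<sigma> s = 0)) \<and>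
     (\<exists>U. propagator n h U \<and> U 1 * \<rho>\<^sub>0 * mat_adjoint (U 1) = \<rho>\<^sub>1)"

definition path_cost :: "nat \<Rightarrow> (pauli list \<Rightarrow> real \<Rightarrow> real) \<Rightarrow> real" where
  "path_cost n h = integral {0..1} (\<lambda>s. \<Sum>\<sigma>\<in>pauli_strings n. \<bar>h \<sigma> s\<bar>)"

text \<open>The infimum is taken in the extended reals, where the infimum of the empty set is
  \<open>\<infinity>\<close>; over \<open>real\<close> it would be an unspecified number.\<close>

definition nielsen_complexity :: "nat \<Rightarrow> nat \<Rightarrow> complex mat \<Rightarrow> complex mat \<Rightarrow> ereal" where
  "nielsen_complexity l n \<rho>\<^sub>0 \<rho>\<^sub>1 =
     (INF h\<in>{h. admissible_path l n \<rho>\<^sub>0 \<rho>\<^sub>1 h}. ereal (path_cost n h))"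


section \<open>The functional calculus is well defined\<close>

lemma adjoint_carrier: "U \<in> carrier_mat d d \<Longrightarrow> mat_adjoint U \<in> carrier_mat d d"
  unfolding mat_adjoint_def by auto

lemma diagonalisation_unique:
  fixes a b :: "nat \<Rightarrow> real"
  assumes U: "unitary d U" and V: "unitary d V"
    and eq: "U * mat_diag d (\<lambda>i. complex_of_real (a i)) * mat_adjoint U
           = V * mat_diag d (\<lambda>i. complex_of_real (b i)) * mat_adjoint V"
  shows "U * mat_diag d (\<lambda>i. complex_of_real (f (a i))) * mat_adjoint U
       = V * mat_diag d (\<lambda>i. complex_of_real (f (b i))) * mat_adjoint V"
proof -
  define W where "W = mat_adjoint V * U"
  have Uc: "U \<in> carrier_mat d d" "mat_adjoint U \<in> carrier_mat d d"
    and Vc: "V \<in> carrier_mat d d" "mat_adjoint V \<in> carrier_mat d d"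
    using U V adjoint_carrier unfolding unitary_def by auto
  have UU: "mat_adjoint U * U = 1\<^sub>m d" "U * mat_adjoint U = 1\<^sub>m d"
    and VV: "mat_adjoint V * V = 1\<^sub>m d" "V * mat_adjoint V = 1\<^sub>m d"
    using U V unfolding unitary_def by auto
  have W: "W \<in> carrier_mat d d" unfolding W_def using Uc Vc by auto
  have move: "U * P * mat_adjoint U = V * Q * mat_adjoint V \<longleftrightarrow> W * P = Q * W"
    if P: "P \<in> carrier_mat d d" and Q: "Q \<in> carrier_mat d d" for P Q
  proof
    note mc = mult_carrier_mat[of _ d d _ d]
    note as = assoc_mult_mat[of _ d d _ d _ d]
    assume e: "U * P * mat_adjoint U = V * Q * mat_adjoint V"
    have "W * P = mat_adjoint V * (U * P * mat_adjoint U) * U"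
      unfolding W_def using Uc Vc P by (simp add: mc as UU)
    also have "\<dots> = mat_adjoint V * (V * (Q * W))"
      unfolding e W_def using Uc Vc Q by (simp add: mc as)
    also have "\<dots> = mat_adjoint V * V * (Q * W)"
      using Vc Q W by (intro as[symmetric] mc)
    also have "\<dots> = Q * W" unfolding VV using mc[OF Q W] by (rule left_mult_one_mat)
    finally show "W * P = Q * W" .
  next
    note mc = mult_carrier_mat[of _ d d _ d]
    note as = assoc_mult_mat[of _ d d _ d _ d]
    assume e: "W * P = Q * W"
    have "V * W = V * mat_adjoint V * U"
      unfolding W_def using Uc Vc by (intro as[symmetric])
    hence VW: "V * W = U" using VV Uc by simp
    have "U * P * mat_adjoint U = V * (W * P) * mat_adjoint U"
      unfolding VW[symmetric] using W Vc P by (simp add: as)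
    also have "\<dots> = V * Q * (W * mat_adjoint U)"
      unfolding e using W Uc Vc Q by (simp add: mc as)
    also have "W * mat_adjoint U = mat_adjoint V"
      unfolding W_def using Uc Vc UU by (simp add: mc as)
    finally show "U * P * mat_adjoint U = V * Q * mat_adjoint V" .
  qed
  have "W * mat_diag d (\<lambda>i. complex_of_real (a i)) = mat_diag d (\<lambda>i. complex_of_real (b i)) * W"
    using move eq by simp
  hence ent: "W $$ (i, j) * complex_of_real (a j) = complex_of_real (b i) * W $$ (i, j)"
    if "i < d" "j < d" for i j
    unfolding mat_diag_mult_left[OF W] mat_diag_mult_right[OF W]
    using that by (auto dest!: arg_cong[where f = "\<lambda>M. M $$ (i, j)"])
  have "W * mat_diag d (\<lambda>i. complex_of_real (f (a i)))
      = mat_diag d (\<lambda>i. complex_of_real (f (b i))) * W"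
    unfolding mat_diag_mult_left[OF W] mat_diag_mult_right[OF W]
  proof (rule eq_matI, goal_cases)
    case (1 i j)
    hence "i < d" "j < d" by auto
    with ent[OF this] show ?case
      by (cases "W $$ (i, j) = 0") auto
  qed auto
  thus ?thesis using move by simp
qed

lemma herm_fun_eq:
  assumes U: "unitary d U"
    and A: "A = U * mat_diag d (\<lambda>i. complex_of_real (e i)) * mat_adjoint U"
  shows "herm_fun f A = U * mat_diag d (\<lambda>i. complex_of_real (f (e i))) * mat_adjoint U"
proof -
  have dim: "dim_row A = d" using U unfolding A unitary_def by auto
  show ?thesis
    unfolding herm_fun_def dim
  proof (intro the_equality, goal_cases)
    case 1
    show ?case using U A by blast
  next
    case (2 B)
    then obtain V b where V: "unitary d V"
      and A': "A = V * mat_diag d (\<lambda>i. complex_of_real (b i)) * mat_adjoint V"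
      and B: "B = V * mat_diag d (\<lambda>i. complex_of_real (f (b i))) * mat_adjoint V"
      by auto
    show ?case unfolding B by (rule diagonalisation_unique[OF V U]) (use A A' in simp)
  qed
qed

end

theory Submission
  imports Defs
begin

text \<open>
  The generator of a path is a combination of Pauli operators, and across any cut a Pauli operator is
  a product \<open>A \<otimes> B\<close> of Hermitian unitaries. Such a product changes the entanglement
  entropy at a rate of at most 2, whatever the dimensions. With \<open>\<lambda>\<^sub>p\<close> the
  eigenvalues of the reduced state, \<open>A'\<close> the matrix of \<open>A\<close> in its eigenbasis
  and \<open>K\<close> the matrix of \<open>B\<close> in the unnormalised Schmidt vectors
  \<open>\<phi>\<^sub>p\<close>, the rate is
  \<open>\<Sum>\<^sub>p\<^sub>q (ln \<lambda>\<^sub>p - ln \<lambda>\<^sub>q) Im (A'\<^sub>p\<^sub>q K\<^sub>p\<^sub>q)\<close> up to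
  sign. Here \<open>sqrt (\<lambda>\<^sub>p \<lambda>\<^sub>q) \<bar>ln \<lambda>\<^sub>p - ln \<lambda>\<^sub>q\<bar> \<le> \<bar>\<lambda>\<^sub>p - \<lambda>\<^sub>q\<bar>\<close>,
  and the rows of \<open>A'\<close> and of \<open>K\<^sub>p\<^sub>q / sqrt (\<lambda>\<^sub>p \<lambda>\<^sub>q)\<close> have norm at most 1.
  Hence \<open>2 * path_cost\<close> dominates the entropy change at every cut, and averaging over the
  cuts gives the theorem with \<open>c = 1/2\<close>.

  Differentiating eigenvalues is avoided: by Klein's inequality the entropy, regularised to
  \<open>- (x + \<epsilon>) ln (x + \<epsilon>)\<close> because of the zero eigenvalues, is supported at each
  time by a function of the path that is differentiable, and one-sided bounds suffice for the mean value
  argument. State vectors are avoided too: a projection satisfies \<open>\<rho> = \<rho> \<rho>\<^sup>*\<close>,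
  so \<open>U \<rho> U\<^sup>* = (U \<rho>) (U \<rho>)\<^sup>*\<close>, and the columns of
  \<open>U \<rho>\<close> serve as an additional index of the second subsystem.
\<close>

section \<open>Diagonalisation of Hermitian matrices\<close>

lemma sum_mult_of_bool_eq:
  fixes f :: "'a \<Rightarrow> 'b :: comm_semiring_1"
  assumes "finite P" "p \<in> P"
  shows "(\<Sum>q\<in>P. f q * of_bool (q = p)) = f p"
  using assms by (simp add: of_bool_def if_distrib[of "(*) _"] sum.delta cong: if_cong)

lemma sum_mult_of_bool_eq':
  fixes f :: "'a \<Rightarrow> 'b :: comm_semiring_1"
  assumes "finite P" "p \<in> P"
  shows "(\<Sum>q\<in>P. f q * of_bool (p = q)) = f p"
  using assms by (simp add: of_bool_def if_distrib[of "(*) _"] sum.delta' cong: if_cong)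

section \<open>Adjoints, products and unitarity of complex matrices\<close>

lemma adjoint_index:
  "i < dim_col A \<Longrightarrow> j < dim_row A \<Longrightarrow> mat_adjoint A $$ (i, j) = cnj ((A :: complex mat) $$ (j, i))"
  unfolding mat_adjoint_def by (simp add: mat_of_rows_index)

lemma adjoint_dim [simp]: "dim_row (mat_adjoint A) = dim_col A" "dim_col (mat_adjoint A) = dim_row A"
  unfolding mat_adjoint_def by auto

lemma mat_mult_index_sum:
  assumes "A \<in> carrier_mat n m" "B \<in> carrier_mat m k" "i < n" "j < k"
  shows "(A * B) $$ (i, j) = (\<Sum>l<m. A $$ (i, l) * B $$ (l, j))"
  using assms by (auto simp: scalar_prod_def lessThan_atLeast0)

lemma adjoint_mult:
  assumes "(A :: complex mat) \<in> carrier_mat n m" "B \<in> carrier_mat m k"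
  shows "mat_adjoint (A * B) = mat_adjoint B * mat_adjoint A"
  using assms
  by (intro eq_matI) (auto simp: adjoint_index scalar_prod_def mult.commute intro!: sum.cong)

lemma unitary_mult:
  assumes "unitary d U" "unitary d V"
  shows "unitary d (U * V)"
proof -
  note c = assms[unfolded unitary_def]
  have cU: "U \<in> carrier_mat d d" "V \<in> carrier_mat d d" "mat_adjoint U \<in> carrier_mat d d"
    "mat_adjoint V \<in> carrier_mat d d" using c adjoint_carrier by auto
  have "mat_adjoint (U * V) * (U * V) = mat_adjoint V * (mat_adjoint U * U) * V"
    using cU by (simp add: adjoint_mult[of _ d d _ d] assoc_mult_mat[of _ d d _ d _ d])
  moreover have "(U * V) * mat_adjoint (U * V) = U * (V * mat_adjoint V) * mat_adjoint U"
    using cU by (simp add: adjoint_mult[of _ d d _ d] assoc_mult_mat[of _ d d _ d _ d])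
  ultimately show ?thesis unfolding unitary_def using c cU by simp
qed

text \<open>Multiplying the vector by a phase makes its first entry real, so that a Householder
  reflection can map the first basis vector to it.\<close>

lemma householder_exists:
  fixes v :: "nat \<Rightarrow> complex"
  assumes norm: "(\<Sum>i<Suc d. (cmod (v i))\<^sup>2) = 1" and real: "v 0 \<in> \<real>"
  shows "\<exists>H. unitary (Suc d) H \<and> mat_adjoint H = H \<and> (\<forall>i<Suc d. H $$ (i, 0) = v i)"
proof (cases "v 0 = 1")
  case True
  \<comment> \<open>Here \<open>v\<close> is the first basis vector, for which the reflection vector
    \<open>w\<close> of the other case would vanish; the identity serves instead.\<close>
  have "(\<Sum>i<d. (cmod (v (Suc i)))\<^sup>2) = 0"
    using norm True unfolding sum.lessThan_Suc_shift by simp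
  hence z: "v (Suc i) = 0" if "i < d" for i using that by (simp add: sum_nonneg_eq_0_iff)
  have "v i = 1\<^sub>m (Suc d) $$ (i, 0)" if "i < Suc d" for i
    using that True z by (cases i) auto
  moreover have "mat_adjoint (1\<^sub>m (Suc d)) = (1\<^sub>m (Suc d) :: complex mat)"
    by (rule eq_matI) (auto simp: adjoint_index)
  ultimately show ?thesis by (intro exI[of _ "1\<^sub>m (Suc d)"]) (auto simp: unitary_def)
next
  case False
  define x where "x = Re (v 0)"
  have v0: "v 0 = complex_of_real x" using real unfolding x_def by simp
  have x2: "x\<^sup>2 \<le> 1"
  proof -
    have "(cmod (v 0))\<^sup>2 \<le> (\<Sum>i<Suc d. (cmod (v i))\<^sup>2)"
      by (intro member_le_sum) auto
    thus ?thesis using norm v0 by simp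
  qed
  have x1: "x < 1" using False v0 x2 by (metis abs_le_square_iff abs_le_D1 abs_one less_eq_real_def of_real_1 one_power2)
  \<comment> \<open>With \<open>w = v - e_0\<close> the reflection is
    \<open>1 - 2 w w* / |w|^2\<close>. As \<open>v 0 = x\<close> is real,
    \<open>|w|^2 = 2 (1 - x)\<close>, which explains the factor \<open>1 / (1 - x)\<close>.\<close>
  define w where "w i = v i - of_bool (i = 0)" for i
  define H where "H = Matrix.mat (Suc d) (Suc d)
    (\<lambda>(i, j). of_bool (i = j) - w i * cnj (w j) / complex_of_real (1 - x))"
  have vv: "(\<Sum>i<d. v (Suc i) * cnj (v (Suc i))) = complex_of_real (1 - x\<^sup>2)"
  proof -
    have "(\<Sum>i<d. (cmod (v (Suc i)))\<^sup>2) = 1 - x\<^sup>2"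
      using norm v0 unfolding sum.lessThan_Suc_shift by simp
    thus ?thesis unfolding complex_norm_square[symmetric] of_real_sum[symmetric] by simp
  qed
  have ww: "(\<Sum>i<Suc d. cnj (w i) * w i) = complex_of_real (2 * (1 - x))"
    using vv unfolding sum.lessThan_Suc_shift w_def
    by (simp add: v0 mult.commute power2_eq_square algebra_simps)
  have Hc: "H \<in> carrier_mat (Suc d) (Suc d)" unfolding H_def by simp
  have adj: "mat_adjoint H = H"
    unfolding H_def by (rule eq_matI) (auto simp: adjoint_index mult.commute)
  have HH: "H * H = 1\<^sub>m (Suc d)"
  proof (rule eq_matI)
    fix i j assume "i < dim_row (1\<^sub>m (Suc d))" "j < dim_col (1\<^sub>m (Suc d))"
    hence ij: "i < Suc d" "j < Suc d" by auto
    define y where "y = complex_of_real (1 - x)"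
    have y: "y \<noteq> 0" unfolding y_def using x1 by simp
    have "(H * H) $$ (i, j) = (\<Sum>l<Suc d. (of_bool (i = l) - w i * cnj (w l) / y) * (of_bool (l = j) - w l * cnj (w j) / y))"
      unfolding mat_mult_index_sum[OF Hc Hc ij] using ij unfolding H_def y_def by (intro sum.cong refl) auto
    also have "\<dots> = (\<Sum>l<Suc d. of_bool (l = i) * of_bool (l = j)) - (\<Sum>l<Suc d. (w l * cnj (w j) / y) * of_bool (l = i))
        - (\<Sum>l<Suc d. (w i * cnj (w l) / y) * of_bool (l = j)) + (w i * cnj (w j) / y\<^sup>2) * (\<Sum>l<Suc d. cnj (w l) * w l)"
      unfolding sum_distrib_left sum.distrib[symmetric] sum_subtractf[symmetric]
      by (intro sum.cong refl) (simp add: algebra_simps power2_eq_square eq_commute)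
    also have "(\<Sum>l<Suc d. of_bool (l = i) * of_bool (l = j)) = (of_bool (j = i) :: complex)"
      by (rule sum_mult_of_bool_eq) (use ij in auto)
    also have "(\<Sum>l<Suc d. (w l * cnj (w j) / y) * of_bool (l = i)) = w i * cnj (w j) / y"
      by (rule sum_mult_of_bool_eq) (use ij in auto)
    also have "(\<Sum>l<Suc d. (w i * cnj (w l) / y) * of_bool (l = j)) = w i * cnj (w j) / y"
      by (rule sum_mult_of_bool_eq) (use ij in auto)
    also have "(\<Sum>l<Suc d. cnj (w l) * w l) = 2 * y" unfolding ww y_def by simp
    finally show "(H * H) $$ (i, j) = 1\<^sub>m (Suc d) $$ (i, j)"
      using y ij by (cases "i = j") (simp_all add: power2_eq_square)
  qed (use Hc in auto)
  have "H $$ (i, 0) = v i" if i: "i < Suc d" for i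
  proof -
    have "cnj (w 0) / complex_of_real (1 - x) = - 1" unfolding w_def v0 using x1 by (simp add: divide_simps)
    hence "w i * cnj (w 0) / complex_of_real (1 - x) = - w i" by (metis mult_minus1_right times_divide_eq_right)
    moreover have "H $$ (i, 0) = of_bool (i = 0) - w i * cnj (w 0) / complex_of_real (1 - x)"
      unfolding H_def using i by simp
    ultimately show ?thesis by (simp add: w_def)
  qed
  thus ?thesis using Hc HH adj unfolding unitary_def by (intro exI[of _ H]) auto
qed

text \<open>The characteristic polynomial has positive degree and splits over the complex numbers,
  so an eigenvector exists. Rescaling gives it norm 1 and a real first entry, the form that
  \<open>householder_exists\<close> demands.\<close>

lemma unit_eigenvector_exists:
  assumes A: "A \<in> carrier_mat (Suc d) (Suc d)"
  shows "\<exists>v k. v \<in> carrier_vec (Suc d) \<and> A *\<^sub>v v = k \<cdot>\<^sub>v v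
    \<and> (\<Sum>i<Suc d. (cmod (v $ i))\<^sup>2) = 1 \<and> vec_index v 0 \<in> \<real>"
proof -
  obtain as where as: "char_poly A = (\<Prod>a\<leftarrow>as. [:- a, 1:])" "length as = Suc d"
    using char_poly_factorized[OF A] by auto
  then obtain k bs where "as = k # bs" by (cases as) auto
  hence "poly (char_poly A) k = 0" unfolding as by simp
  hence "eigenvalue A k" using eigenvalue_root_char_poly[OF A] by simp
  then obtain u where u: "u \<in> carrier_vec (Suc d)" "u \<noteq> 0\<^sub>v (Suc d)" "A *\<^sub>v u = k \<cdot>\<^sub>v u"
    using A unfolding eigenvalue_def eigenvector_def by auto
  define N where "N = (\<Sum>i<Suc d. (cmod (u $ i))\<^sup>2)"
  obtain i where "i < Suc d" "u $ i \<noteq> 0" using u(1,2) by (metis carrier_vecD eq_vecI index_zero_vec)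
  hence N: "N > 0" unfolding N_def by (intro sum_pos2[of _ i]) auto
  \<comment> \<open>The factor removes the norm and the phase of the first entry. A vanishing first
    entry has no phase, and \<open>sgn 0 = 0\<close> would annihilate the vector, hence the case
    distinction.\<close>
  define z where "z = (if u $ 0 = 0 then 1 else cnj (sgn (u $ 0))) / complex_of_real (sqrt N)"
  have cz: "(cmod z)\<^sup>2 = 1 / N"
    using N unfolding z_def by (auto simp: norm_divide norm_sgn power_divide)
  have "(\<Sum>i<Suc d. (cmod ((z \<cdot>\<^sub>v u) $ i))\<^sup>2) = (\<Sum>i<Suc d. (1 / N) * (cmod (u $ i))\<^sup>2)"
    using u(1) by (intro sum.cong refl) (simp add: norm_mult power_mult_distrib cz)
  also have "\<dots> = 1" unfolding sum_distrib_left[symmetric] N_def[symmetric] using N by simp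
  finally have n1: "(\<Sum>i<Suc d. (cmod ((z \<cdot>\<^sub>v u) $ i))\<^sup>2) = 1" .
  have "cnj (sgn y) * y = complex_of_real (cmod y)" for y :: complex
    by (cases "y = 0") (simp_all add: sgn_eq mult.commute complex_norm_square[symmetric] power2_eq_square)
  hence re: "vec_index (z \<cdot>\<^sub>v u) 0 \<in> \<real>" using u(1) unfolding z_def by (auto simp flip: of_real_divide)
  have "A *\<^sub>v (z \<cdot>\<^sub>v u) = k \<cdot>\<^sub>v (z \<cdot>\<^sub>v u)"
    using A u by (simp add: mult_mat_vec[of A "Suc d" "Suc d"] smult_smult_assoc mult.commute)
  thus ?thesis using n1 re u(1) by (intro exI[of _ "z \<cdot>\<^sub>v u"] exI[of _ k]) auto
qed

text \<open>Induction by deflation. A Householder reflection \<open>H\<close> whose first column is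
  a unit eigenvector conjugates \<open>A\<close> to a Hermitian matrix \<open>C\<close> with first
  column \<open>(k, 0, ..., 0)\<close>. By symmetry the first row has the same form, so
  \<open>C\<close> is block diagonal and the induction hypothesis applies to the lower block
  \<open>D\<close>.\<close>

lemma hermitian_diagonalisation:
  assumes "A \<in> carrier_mat d d" "mat_adjoint A = A"
  shows "\<exists>U e. unitary d U \<and> A = U * mat_diag d (\<lambda>i. complex_of_real (e i)) * mat_adjoint U"
  using assms
proof (induction d arbitrary: A)
  case 0
  thus ?case
    by (intro exI[of _ "1\<^sub>m 0"] exI[of _ "\<lambda>_. 0"])
      (auto simp: unitary_def mat_adjoint_def intro!: eq_matI)
next
  case (Suc d)
  let ?n = "Suc d"
  note as = assoc_mult_mat[of _ ?n ?n _ ?n _ ?n]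
  note mc = mult_carrier_mat[of _ ?n ?n _ ?n]
  obtain v k where v: "v \<in> carrier_vec ?n" "A *\<^sub>v v = k \<cdot>\<^sub>v v"
    "(\<Sum>i<?n. (cmod (v $ i))\<^sup>2) = 1" "vec_index v 0 \<in> \<real>"
    using unit_eigenvector_exists[OF Suc.prems(1)] by blast
  obtain H where H: "unitary ?n H" "mat_adjoint H = H" "\<And>i. i < ?n \<Longrightarrow> H $$ (i, 0) = v $ i"
    using householder_exists[of "\<lambda>i. v $ i" d] v(3,4) by blast
  have Hc: "H \<in> carrier_mat ?n ?n" and HH: "H * H = 1\<^sub>m ?n" using H(1,2) unfolding unitary_def by auto
  define C where "C = H * A * H"
  have Cc: "C \<in> carrier_mat ?n ?n" unfolding C_def using Hc Suc.prems by auto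
  have Cadj: "mat_adjoint C = C"
    unfolding C_def using Hc Suc.prems
    by (simp add: adjoint_mult[of _ ?n ?n _ ?n] mc as H(2))
  have AH: "(A * H) $$ (i, 0) = k * H $$ (i, 0)" if i: "i < ?n" for i
  proof -
    have "(A * H) $$ (i, 0) = (\<Sum>l<?n. A $$ (i, l) * v $ l)"
      using mat_mult_index_sum[OF Suc.prems(1) Hc i, of 0] H(3) by simp
    also have "\<dots> = (A *\<^sub>v v) $ i"
      using Suc.prems(1) v(1) i by (auto simp: scalar_prod_def lessThan_atLeast0)
    finally show ?thesis using v(1,2) i H(3) by simp
  qed
  have C0: "C $$ (i, 0) = (if i = 0 then k else 0)" if i: "i < ?n" for i
  proof -
    have "C $$ (i, 0) = (H * (A * H)) $$ (i, 0)"
      unfolding C_def using Hc Suc.prems by (simp add: as)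
    also have "\<dots> = (\<Sum>l<?n. H $$ (i, l) * (A * H) $$ (l, 0))"
      using i Hc Suc.prems by (intro mat_mult_index_sum) auto
    also have "\<dots> = k * (\<Sum>l<?n. H $$ (i, l) * H $$ (l, 0))"
      unfolding sum_distrib_left by (intro sum.cong refl) (simp add: AH)
    also have "(\<Sum>l<?n. H $$ (i, l) * H $$ (l, 0)) = (H * H) $$ (i, 0)"
      by (rule mat_mult_index_sum[OF Hc Hc i, symmetric]) simp
    finally show ?thesis unfolding HH using i by simp
  qed
  have Csym: "C $$ (i, j) = cnj (C $$ (j, i))" if "i < ?n" "j < ?n" for i j
    using adjoint_index[of i C j] that Cc unfolding Cadj by auto
  \<comment> \<open>The eigenvalue is the corner entry of a Hermitian matrix, hence real.\<close>
  have k: "k = complex_of_real (Re k)"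
    using Csym[of 0 0] C0[of 0] by (simp add: complex_eq_iff)
  define D where "D = Matrix.mat d d (\<lambda>(i, j). C $$ (Suc i, Suc j))"
  have Dc: "D \<in> carrier_mat d d" unfolding D_def by simp
  have "mat_adjoint D = D"
    unfolding D_def by (rule eq_matI) (auto simp: adjoint_index Csym[symmetric])
  from Suc.IH[OF Dc this] obtain U e where U: "unitary d U"
    and DU: "D = U * mat_diag d (\<lambda>i. complex_of_real (e i)) * mat_adjoint U" by blast
  have Uc: "U \<in> carrier_mat d d" "mat_adjoint U \<in> carrier_mat d d"
    using U adjoint_carrier unfolding unitary_def by auto
  \<comment> \<open>\<open>W\<close> is the block matrix with blocks 1 and \<open>U\<close>, so that
    \<open>C = W E W*\<close> with the eigenvalue \<open>k\<close> put in front of those of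
    \<open>D\<close>.\<close>
  define W where "W = Matrix.mat ?n ?n (\<lambda>(i, j). case i of 0 \<Rightarrow> of_bool (j = 0)
    | Suc i' \<Rightarrow> (case j of 0 \<Rightarrow> 0 | Suc j' \<Rightarrow> U $$ (i', j')))"
  define e' where "e' i = (case i of 0 \<Rightarrow> Re k | Suc i' \<Rightarrow> e i')" for i
  have W_idx: "W $$ (0, 0) = 1" "j < d \<Longrightarrow> W $$ (0, Suc j) = 0" "i < d \<Longrightarrow> W $$ (Suc i, 0) = 0"
    "i < d \<Longrightarrow> j < d \<Longrightarrow> W $$ (Suc i, Suc j) = U $$ (i, j)" for i j
    unfolding W_def by auto
  have Wc: "W \<in> carrier_mat ?n ?n" "mat_adjoint W \<in> carrier_mat ?n ?n"
    unfolding W_def by (auto intro!: carrier_matI)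
  have Wa_idx: "i < ?n \<Longrightarrow> j < ?n \<Longrightarrow> mat_adjoint W $$ (i, j) = cnj (W $$ (j, i))" for i j
    using Wc by (intro adjoint_index) auto
  have Ua_idx: "i < d \<Longrightarrow> j < d \<Longrightarrow> mat_adjoint U $$ (i, j) = cnj (U $$ (j, i))" for i j
    using Uc by (intro adjoint_index) auto
  have "(\<Sum>l<d. cnj (U $$ (l, i)) * U $$ (l, j)) = of_bool (i = j)" if "i < d" "j < d" for i j
  proof -
    have "(mat_adjoint U * U) $$ (i, j) = (\<Sum>l<d. mat_adjoint U $$ (i, l) * U $$ (l, j))"
      using that Uc by (intro mat_mult_index_sum)
    also have "\<dots> = (\<Sum>l<d. cnj (U $$ (l, i)) * U $$ (l, j))"
      using that by (intro sum.cong refl) (simp add: Ua_idx)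
    finally show ?thesis using U that unfolding unitary_def by (simp split: if_splits)
  qed
  note UU = this
  have "mat_adjoint W * W = 1\<^sub>m ?n"
  proof (rule eq_matI)
    fix i j assume "i < dim_row (1\<^sub>m ?n)" "j < dim_col (1\<^sub>m ?n)"
    hence ij: "i < ?n" "j < ?n" by auto
    have "(mat_adjoint W * W) $$ (i, j) = (\<Sum>l<?n. cnj (W $$ (l, i)) * W $$ (l, j))"
      using ij mat_mult_index_sum[OF Wc(2,1) ij] by (simp add: Wa_idx del: sum.lessThan_Suc)
    thus "(mat_adjoint W * W) $$ (i, j) = 1\<^sub>m ?n $$ (i, j)"
      unfolding sum.lessThan_Suc_shift using ij by (cases i; cases j) (simp_all add: W_idx UU)
  qed (use Wc in auto)
  moreover from this have "W * mat_adjoint W = 1\<^sub>m ?n" by (rule mat_mult_left_right_inverse[OF Wc(2,1)])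
  ultimately have W: "unitary ?n W" using Wc unfolding unitary_def by blast
  let ?E = "mat_diag ?n (\<lambda>i. complex_of_real (e' i))"
  have D_idx: "(\<Sum>l<d. U $$ (i, l) * complex_of_real (e l) * cnj (U $$ (j, l))) = C $$ (Suc i, Suc j)"
    if "i < d" "j < d" for i j
  proof -
    have "C $$ (Suc i, Suc j) = D $$ (i, j)" unfolding D_def using that by simp
    also have "\<dots> = (\<Sum>l<d. U $$ (i, l) * complex_of_real (e l) * mat_adjoint U $$ (l, j))"
      unfolding DU mat_diag_mult_right[OF Uc(1)]
      using that Uc by (subst mat_mult_index_sum[of _ d d _ d]) auto
    also have "\<dots> = (\<Sum>l<d. U $$ (i, l) * complex_of_real (e l) * cnj (U $$ (j, l)))"
      using that by (intro sum.cong refl) (simp add: Ua_idx)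
    finally show ?thesis ..
  qed
  have CW: "C = W * ?E * mat_adjoint W"
  proof (rule eq_matI)
    fix i j assume "i < dim_row (W * ?E * mat_adjoint W)" "j < dim_col (W * ?E * mat_adjoint W)"
    hence ij: "i < ?n" "j < ?n" using Wc by auto
    have "(W * ?E * mat_adjoint W) $$ (i, j) = (\<Sum>l<?n. (W * ?E) $$ (i, l) * mat_adjoint W $$ (l, j))"
      using ij Wc by (intro mat_mult_index_sum) auto
    also have "\<dots> = (\<Sum>l<?n. W $$ (i, l) * complex_of_real (e' l) * cnj (W $$ (j, l)))"
      unfolding mat_diag_mult_right[OF Wc(1)] using ij by (intro sum.cong refl) (simp add: Wa_idx)
    also have "\<dots> = C $$ (i, j)"
      unfolding sum.lessThan_Suc_shift using ij C0[of i] Csym[of 0 j] C0[of j] k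
      by (cases i; cases j) (simp_all add: W_idx D_idx e'_def)
    finally show "C $$ (i, j) = (W * ?E * mat_adjoint W) $$ (i, j)" ..
  qed (use Wc Cc in auto)
  have "A = (H * H) * A * (H * H)" unfolding HH using Suc.prems by simp
  also have "\<dots> = H * C * H" unfolding C_def using Hc Suc.prems by (simp add: as mc)
  also have "\<dots> = (H * W) * ?E * mat_adjoint (H * W)"
    unfolding CW using Hc Wc H(2) by (simp add: as mc adjoint_mult[of _ ?n ?n _ ?n])
  finally show ?case using unitary_mult[OF H(1) W] by blast
qed

section \<open>The rate of entropy change under a product Hamiltonian\<close>

text \<open>Vectors and operators are functions on an index set instead of matrices, because the
  second subsystem will be indexed by pairs.\<close>

definition inner_on :: "'z set \<Rightarrow> ('z \<Rightarrow> complex) \<Rightarrow> ('z \<Rightarrow> complex) \<Rightarrow> complex" where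
  "inner_on Z f g = (\<Sum>z\<in>Z. cnj (f z) * g z)"

definition apply_on :: "'z set \<Rightarrow> ('z \<Rightarrow> 'z \<Rightarrow> complex) \<Rightarrow> ('z \<Rightarrow> complex) \<Rightarrow> 'z \<Rightarrow> complex" where
  "apply_on Z B f = (\<lambda>z. \<Sum>w\<in>Z. B z w * f w)"

definition hermitian_on :: "'z set \<Rightarrow> ('z \<Rightarrow> 'z \<Rightarrow> complex) \<Rightarrow> bool" where
  "hermitian_on Z B \<longleftrightarrow> (\<forall>z\<in>Z. \<forall>w\<in>Z. B z w = cnj (B w z))"

text \<open>This is \<open>B* B = 1\<close> written in entries: the columns are orthonormal.\<close>

definition isometric_on :: "'z set \<Rightarrow> ('z \<Rightarrow> 'z \<Rightarrow> complex) \<Rightarrow> bool" where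
  "isometric_on Z B \<longleftrightarrow>
     (\<forall>w\<in>Z. \<forall>w'\<in>Z. (\<Sum>z\<in>Z. cnj (B z w) * B z w') = of_bool (w = w'))"

lemma inner_on_cnj: "cnj (inner_on Z f g) = inner_on Z g f"
  unfolding inner_on_def by (simp add: mult.commute)

lemma inner_on_self: "inner_on Z f f = complex_of_real (\<Sum>z\<in>Z. (cmod (f z))\<^sup>2)"
  unfolding inner_on_def of_real_sum
  by (intro sum.cong refl) (metis complex_norm_square mult.commute)

lemma inner_on_sum_right:
  "inner_on Z f (\<lambda>z. \<Sum>i\<in>I. c i * g i z) = (\<Sum>i\<in>I. c i * inner_on Z f (g i))"
  unfolding inner_on_def sum_distrib_left by (subst sum.swap) (simp add: mult_ac)

lemma inner_on_sum_left:
  "inner_on Z (\<lambda>z. \<Sum>i\<in>I. c i * g i z) f = (\<Sum>i\<in>I. cnj (c i) * inner_on Z (g i) f)"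
  unfolding inner_on_def sum_distrib_left cnj_sum sum_distrib_right
  by (subst sum.swap) (simp add: mult_ac)

lemma inner_on_minus_self:
  "inner_on Z (\<lambda>z. f z - g z) (\<lambda>z. f z - g z)
    = inner_on Z f f - inner_on Z f g - inner_on Z g f + inner_on Z g g"
  unfolding inner_on_def by (simp add: algebra_simps sum.distrib sum_subtractf)

lemma inner_on_apply_on:
  assumes "hermitian_on Z B"
  shows "inner_on Z f (apply_on Z B g) = inner_on Z (apply_on Z B f) g"
proof -
  have "inner_on Z f (apply_on Z B g) = (\<Sum>z\<in>Z. \<Sum>w\<in>Z. cnj (f z) * B z w * g w)"
    unfolding inner_on_def apply_on_def by (simp add: sum_distrib_left mult_ac)
  also have "\<dots> = (\<Sum>z\<in>Z. \<Sum>w\<in>Z. cnj (B w z * f z) * g w)"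
  proof (intro sum.cong refl)
    fix z w assume "z \<in> Z" "w \<in> Z"
    hence "B z w = cnj (B w z)" using assms unfolding hermitian_on_def by blast
    thus "cnj (f z) * B z w * g w = cnj (B w z * f z) * g w" by simp
  qed
  also have "\<dots> = inner_on Z (apply_on Z B f) g"
    unfolding inner_on_def apply_on_def by (subst sum.swap) (simp add: sum_distrib_right)
  finally show ?thesis .
qed

lemma inner_on_isometric:
  assumes fin: "finite Z" and B: "isometric_on Z B"
  shows "inner_on Z (apply_on Z B f) (apply_on Z B g) = inner_on Z f g"
proof -
  have "inner_on Z (apply_on Z B f) (apply_on Z B g)
      = (\<Sum>z\<in>Z. \<Sum>w\<in>Z. \<Sum>w'\<in>Z. (cnj (f w) * g w') * (cnj (B z w) * B z w'))"
    unfolding inner_on_def apply_on_def cnj_sum sum_product by (simp add: mult_ac)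
  also have "\<dots> = (\<Sum>w\<in>Z. \<Sum>w'\<in>Z. \<Sum>z\<in>Z. (cnj (f w) * g w') * (cnj (B z w) * B z w'))"
    by (subst sum.swap, rule sum.cong[OF refl], rule sum.swap)
  also have "\<dots> = (\<Sum>w\<in>Z. \<Sum>w'\<in>Z. (cnj (f w) * g w') * of_bool (w = w'))"
    using B unfolding isometric_on_def sum_distrib_left[symmetric] by (intro sum.cong refl) auto
  also have "\<dots> = inner_on Z f g"
    unfolding inner_on_def using fin by (intro sum.cong refl) (simp add: sum_mult_of_bool_eq')
  finally show ?thesis .
qed

text \<open>Families with zero vectors are allowed: these contribute nothing because \<open>x / 0 = 0\<close>.\<close>

lemma bessel_inequality:
  fixes \<phi> :: "'p \<Rightarrow> 'z \<Rightarrow> complex"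
  assumes finP: "finite P"
    and orth: "\<And>p q. p \<in> P \<Longrightarrow> q \<in> P \<Longrightarrow>
      inner_on Z (\<phi> p) (\<phi> q) = complex_of_real (of_bool (p = q) * lam p)"
  shows "(\<Sum>p\<in>P. (cmod (inner_on Z (\<phi> p) \<xi>))\<^sup>2 / lam p) \<le> (\<Sum>z\<in>Z. (cmod (\<xi> z))\<^sup>2)"
proof -
  \<comment> \<open>\<open>\<eta>\<close> is the orthogonal projection of \<open>\<xi>\<close> onto
    the span of the family. The products of \<open>\<eta>\<close> with \<open>\<xi>\<close> and with
    itself all equal \<open>S\<close>, so the squared norm of \<open>\<xi> - \<eta>\<close> is that
    of \<open>\<xi>\<close> minus \<open>S\<close>; it is nonnegative.\<close>
  define a where "a p = inner_on Z (\<phi> p) \<xi> / complex_of_real (lam p)" for p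
  define \<eta> where "\<eta> = (\<lambda>z. \<Sum>p\<in>P. a p * \<phi> p z)"
  define S where "S = (\<Sum>p\<in>P. (cmod (inner_on Z (\<phi> p) \<xi>))\<^sup>2 / lam p)"
  have e1: "inner_on Z \<eta> \<xi> = complex_of_real S"
    unfolding \<eta>_def inner_on_sum_left S_def of_real_sum a_def
    by (intro sum.cong refl) (simp add: complex_norm_square[symmetric] mult.commute del: of_real_power)
  have \<eta>\<phi>: "inner_on Z \<eta> (\<phi> p) = cnj (a p) * lam p" if p: "p \<in> P" for p
  proof -
    have "inner_on Z \<eta> (\<phi> p) = (\<Sum>q\<in>P. (cnj (a q) * lam q) * of_bool (q = p))"
      unfolding \<eta>_def inner_on_sum_left by (intro sum.cong refl) (simp add: orth p)
    thus ?thesis using finP p by (simp add: sum_mult_of_bool_eq)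
  qed
  have "inner_on Z \<eta> \<eta> = (\<Sum>p\<in>P. a p * inner_on Z \<eta> (\<phi> p))"
    unfolding \<eta>_def inner_on_sum_right ..
  also have "\<dots> = (\<Sum>p\<in>P. a p * (cnj (a p) * lam p))"
    by (intro sum.cong refl) (simp add: \<eta>\<phi>)
  also have "\<dots> = complex_of_real S"
    unfolding S_def of_real_sum
    by (intro sum.cong refl)
      (auto simp: a_def complex_norm_square[symmetric] divide_simps power2_eq_square mult_ac simp del: of_real_power)
  finally have e2: "inner_on Z \<eta> \<eta> = complex_of_real S" .
  have e3: "inner_on Z \<xi> \<eta> = complex_of_real S"
    using e1 inner_on_cnj[of Z \<eta> \<xi>] by simp
  have "complex_of_real (\<Sum>z\<in>Z. (cmod (\<xi> z - \<eta> z))\<^sup>2)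
      = complex_of_real ((\<Sum>z\<in>Z. (cmod (\<xi> z))\<^sup>2) - S)"
    unfolding inner_on_self[symmetric] inner_on_minus_self e1 e2 e3 by (simp add: inner_on_self)
  hence "(\<Sum>z\<in>Z. (cmod (\<xi> z - \<eta> z))\<^sup>2) = (\<Sum>z\<in>Z. (cmod (\<xi> z))\<^sup>2) - S"
    unfolding of_real_eq_iff .
  thus ?thesis unfolding S_def[symmetric] by (smt (verit) sum_nonneg zero_le_power2)
qed

text \<open>Cauchy-Schwarz for rows of norm at most 1, in the form that follows from
  \<open>x k \<le> (x^2 + k^2) / 2\<close>.\<close>

lemma weighted_row_bound:
  fixes x k w :: "'p \<Rightarrow> real"
  assumes "(\<Sum>q\<in>P. (x q)\<^sup>2) \<le> 1" "(\<Sum>q\<in>P. (k q)\<^sup>2) \<le> 1"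
  shows "(\<Sum>q\<in>P. x q * k q) \<le> 1"
proof -
  have "(\<Sum>q\<in>P. x q * k q) \<le> (\<Sum>q\<in>P. ((x q)\<^sup>2 + (k q)\<^sup>2) / 2)"
    by (intro sum_mono) (use sum_squares_bound in \<open>simp add: field_simps\<close>)
  also have "\<dots> = ((\<Sum>q\<in>P. (x q)\<^sup>2) + (\<Sum>q\<in>P. (k q)\<^sup>2)) / 2"
    by (simp add: sum.distrib sum_divide_distrib[symmetric])
  finally show ?thesis using assms by simp
qed

text \<open>The imaginary part \<open>T p q\<close> of \<open>A p q * K p q\<close> is
  antisymmetric, so the weights \<open>2 * c p\<close> may be replaced by the differences
  \<open>c p - c q\<close>. The hypothesis on \<open>c\<close> trades such a difference, multiplied
  by \<open>sqrt (lam p * lam q)\<close>, for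
  \<open>\<bar>lam p - lam q\<bar> \<le> lam p + lam q\<close>. What remains are two equal sums of
  \<open>lam p\<close> against products of rows of norm at most 1, each bounded by the trace
  1.\<close>

lemma eigenbasis_rate_bound:
  fixes \<phi> :: "'p \<Rightarrow> 'z \<Rightarrow> complex" and A :: "'p \<Rightarrow> 'p \<Rightarrow> complex" and lam c :: "'p \<Rightarrow> real"
  assumes finP: "finite P" and finZ: "finite Z"
    and orth: "\<And>p q. p \<in> P \<Longrightarrow> q \<in> P \<Longrightarrow>
      inner_on Z (\<phi> p) (\<phi> q) = complex_of_real (of_bool (p = q) * lam p)"
    and hB: "hermitian_on Z B" and iB: "isometric_on Z B"
    and hA: "hermitian_on P A" and iA: "\<And>p. p \<in> P \<Longrightarrow> (\<Sum>q\<in>P. (cmod (A p q))\<^sup>2) \<le> 1"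
    and lam1: "(\<Sum>p\<in>P. lam p) = 1"
    and c: "\<And>p q. p \<in> P \<Longrightarrow> q \<in> P \<Longrightarrow> sqrt (lam p * lam q) * \<bar>c p - c q\<bar> \<le> \<bar>lam p - lam q\<bar>"
  shows "\<bar>\<Sum>p\<in>P. c p * (2 * Im (\<Sum>q\<in>P. A p q * inner_on Z (\<phi> p) (apply_on Z B (\<phi> q))))\<bar> \<le> 2"
proof -
  define K where "K p q = inner_on Z (\<phi> p) (apply_on Z B (\<phi> q))" for p q
  define T where "T p q = Im (A p q * K p q)" for p q
  have lam_sum: "lam p = (\<Sum>z\<in>Z. (cmod (\<phi> p z))\<^sup>2)" if "p \<in> P" for p
    using orth[OF that that] unfolding inner_on_self of_real_eq_iff by simp
  have lam0: "lam p \<ge> 0" if "p \<in> P" for p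
    unfolding lam_sum[OF that] by (intro sum_nonneg) auto
  have K_sym: "K q p = cnj (K p q)" for p q
    unfolding K_def inner_on_cnj inner_on_apply_on[OF hB] ..
  have A_sym: "A q p = cnj (A p q)" if "p \<in> P" "q \<in> P" for p q
    using hA that unfolding hermitian_on_def by blast
  have A_norm: "cmod (A q p) = cmod (A p q)" if "p \<in> P" "q \<in> P" for p q
    unfolding A_sym[OF that] by simp
  have T_anti: "T q p = - T p q" if "p \<in> P" "q \<in> P" for p q
    unfolding T_def K_sym[of q p] A_sym[OF that] by simp
  \<comment> \<open>Bessel's inequality for the vector \<open>B \<phi>_q\<close>, which has the norm
    of \<open>\<phi>_q\<close> because \<open>B\<close> is isometric.\<close>
  have K_col: "(\<Sum>p\<in>P. (cmod (K p q))\<^sup>2 / lam p) \<le> lam q" if q: "q \<in> P" for q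
  proof -
    have "complex_of_real (\<Sum>z\<in>Z. (cmod (apply_on Z B (\<phi> q) z))\<^sup>2) = complex_of_real (lam q)"
      unfolding inner_on_self[symmetric] inner_on_isometric[OF finZ iB] using orth[OF q q] by simp
    thus ?thesis using bessel_inequality[OF finP orth, of "apply_on Z B (\<phi> q)"]
      unfolding K_def of_real_eq_iff by simp
  qed
  \<comment> \<open>A vanishing \<open>lam p\<close> is the squared norm of \<open>\<phi> p\<close>,
    so this vector is zero; the divisions by zero below therefore lose nothing.\<close>
  have K0: "K p q = 0" if "p \<in> P" "lam p = 0" for p q
  proof -
    have "\<forall>z\<in>Z. (cmod (\<phi> p z))\<^sup>2 = 0"
      using that(2) finZ unfolding lam_sum[OF that(1)] by (subst (asm) sum_nonneg_eq_0_iff) auto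
    thus ?thesis unfolding K_def inner_on_def by simp
  qed
  hence K0': "K q p = 0" if "p \<in> P" "lam p = 0" for p q
    using that K_sym[of q p] by simp
  \<comment> \<open>Absolute values of the matrix of \<open>B\<close> in the normalised Schmidt
    vectors; rows and columns with \<open>lam = 0\<close> are zero.\<close>
  define k where "k p q = cmod (K p q) / sqrt (lam p * lam q)" for p q
  have k0: "k p q \<ge> 0" if "p \<in> P" "q \<in> P" for p q unfolding k_def using lam0 that by simp
  have k_sym: "k q p = k p q" for p q
    unfolding k_def K_sym[of q p] by (simp add: mult.commute)
  have k_col: "(\<Sum>p\<in>P. (k p q)\<^sup>2) \<le> 1" if q: "q \<in> P" for q
  proof -
    have "(\<Sum>p\<in>P. (k p q)\<^sup>2) = (\<Sum>p\<in>P. (cmod (K p q))\<^sup>2 / lam p) / lam q"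
      unfolding sum_divide_distrib k_def using lam0 q
      by (intro sum.cong refl) (simp add: power_divide real_sqrt_mult power_mult_distrib)
    also have "\<dots> \<le> 1" using K_col[OF q] lam0[OF q] by (auto simp: divide_le_eq_1 less_le)
    finally show ?thesis .
  qed
  have bound: "\<bar>(c p - c q) * T p q\<bar> \<le> cmod (A p q) * k p q * (lam p + lam q)" if pq: "p \<in> P" "q \<in> P" for p q
  proof (cases "lam p = 0 \<or> lam q = 0")
    case True
    hence "K p q = 0" using K0 K0' pq by blast
    thus ?thesis unfolding T_def k_def by simp
  next
    case False
    hence pos: "lam p > 0" "lam q > 0" using lam0 pq by (auto simp: less_le)
    have "\<bar>T p q\<bar> \<le> cmod (A p q) * cmod (K p q)"
      unfolding T_def by (metis abs_Im_le_cmod norm_mult)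
    also have "\<dots> = cmod (A p q) * k p q * sqrt (lam p * lam q)" unfolding k_def using pos by simp
    finally have "\<bar>(c p - c q) * T p q\<bar> \<le> \<bar>c p - c q\<bar> * (cmod (A p q) * k p q * sqrt (lam p * lam q))"
      unfolding abs_mult by (intro mult_left_mono) auto
    also have "\<dots> = cmod (A p q) * k p q * (sqrt (lam p * lam q) * \<bar>c p - c q\<bar>)" by simp
    also have "\<dots> \<le> cmod (A p q) * k p q * (lam p + lam q)"
      using c[OF pq] pos k0[OF pq] by (intro mult_left_mono) auto
    finally show ?thesis .
  qed
  have cT: "(\<Sum>p\<in>P. \<Sum>q\<in>P. c q * T p q) = - (\<Sum>p\<in>P. \<Sum>q\<in>P. c p * T p q)"
  proof -
    have "(\<Sum>p\<in>P. \<Sum>q\<in>P. c q * T p q) = (\<Sum>p\<in>P. \<Sum>q\<in>P. c p * T q p)" by (rule sum.swap)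
    also have "\<dots> = (\<Sum>p\<in>P. \<Sum>q\<in>P. - (c p * T p q))" by (intro sum.cong refl) (subst T_anti, auto)
    finally show ?thesis by (simp add: sum_negf)
  qed
  have "(\<Sum>p\<in>P. c p * (2 * Im (\<Sum>q\<in>P. A p q * K p q))) = 2 * (\<Sum>p\<in>P. \<Sum>q\<in>P. c p * T p q)"
    unfolding T_def Im_sum sum_distrib_left by (intro sum.cong refl) simp
  also have "\<dots> = (\<Sum>p\<in>P. \<Sum>q\<in>P. (c p - c q) * T p q)"
    using cT by (simp add: left_diff_distrib sum_subtractf)
  finally have eq: "(\<Sum>p\<in>P. c p * (2 * Im (\<Sum>q\<in>P. A p q * K p q))) = (\<Sum>p\<in>P. \<Sum>q\<in>P. (c p - c q) * T p q)" .
  have "\<bar>\<Sum>p\<in>P. \<Sum>q\<in>P. (c p - c q) * T p q\<bar> \<le> (\<Sum>p\<in>P. \<Sum>q\<in>P. \<bar>(c p - c q) * T p q\<bar>)"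
    by (intro order.trans[OF sum_abs] sum_mono sum_abs)
  also have "\<dots> \<le> (\<Sum>p\<in>P. \<Sum>q\<in>P. cmod (A p q) * k p q * (lam p + lam q))"
    by (intro sum_mono bound)
  also have "\<dots> = (\<Sum>p\<in>P. lam p * (\<Sum>q\<in>P. cmod (A p q) * k p q))
      + (\<Sum>p\<in>P. \<Sum>q\<in>P. lam q * (cmod (A p q) * k p q))"
    by (simp add: algebra_simps sum.distrib sum_distrib_left)
  also have "(\<Sum>p\<in>P. \<Sum>q\<in>P. lam q * (cmod (A p q) * k p q))
      = (\<Sum>p\<in>P. lam p * (\<Sum>q\<in>P. cmod (A p q) * k p q))"
    unfolding sum_distrib_left
    by (subst sum.swap, intro sum.cong refl) (simp add: k_sym A_norm)
  also have "(\<Sum>p\<in>P. lam p * (\<Sum>q\<in>P. cmod (A p q) * k p q)) \<le> (\<Sum>p\<in>P. lam p * 1)"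
    using lam0 iA k_col k_sym by (intro sum_mono mult_left_mono weighted_row_bound) simp_all
  finally show ?thesis using lam1 eq unfolding K_def by simp
qed

section \<open>Increments of functions with a differentiable support\<close>

text \<open>\<open>F\<close> itself need not be differentiable. The support condition bounds
  \<open>F t - F s\<close> for \<open>s < t\<close> by an increment of \<open>Q\<close>, so the left
  slopes of \<open>F\<close> are at most those of \<open>G\<close>. With a slack
  \<open>\<eta>\<close> the points \<open>t\<close> with \<open>\<Phi> 1 \<le> \<Phi> t\<close> form
  a closed set, and its least element cannot be positive.\<close>

lemma increment_le_of_left_support:
  fixes F G g :: "real \<Rightarrow> real"
  assumes cont: "continuous_on {0..1} F"
    and G: "\<And>t. t \<in> {0..1} \<Longrightarrow> (G has_real_derivative g t) (at t within {0..1})"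
    and supp: "\<And>t. t \<in> {0..1} \<Longrightarrow> \<exists>Q D. (Q has_real_derivative D) (at t within {0..1}) \<and> D \<le> g t
        \<and> (\<forall>s\<in>{0..1}. F t - F s \<le> Q t - Q s)"
  shows "F 1 - F 0 \<le> G 1 - G 0"
proof (rule field_le_epsilon)
  fix \<eta> :: real
  assume \<eta>: "\<eta> > 0"
  define \<Phi> where "\<Phi> t = F t - G t - \<eta> * t" for t
  define T where "T = {t \<in> {0..1}. \<Phi> 1 \<le> \<Phi> t}"
  have "continuous_on {0..1} G"
    using G by (meson DERIV_continuous continuous_on_eq_continuous_within)
  hence c\<Phi>: "continuous_on {0..1} \<Phi>"
    unfolding \<Phi>_def using cont by (intro continuous_intros)
  have "closed T"
    unfolding T_def by (intro continuous_on_closed_Collect_le continuous_intros c\<Phi>)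
  moreover have T1: "1 \<in> T" and bT: "bdd_below T" unfolding T_def by (auto intro!: bdd_belowI[of _ 0])
  ultimately have t0T: "Inf T \<in> T" by (intro closed_contains_Inf) auto
  define t0 where "t0 = Inf T"
  have t0: "t0 \<in> {0..1}" "\<Phi> 1 \<le> \<Phi> t0" using t0T unfolding T_def t0_def by auto
  have "t0 = 0"
  proof (rule ccontr)
    assume "t0 \<noteq> 0"
    hence pos: "t0 > 0" using t0 by auto
    from supp[OF t0(1)] obtain Q D where Q: "(Q has_real_derivative D) (at t0 within {0..1})"
      and D: "D \<le> g t0" and FQ: "\<And>s. s \<in> {0..1} \<Longrightarrow> F t0 - F s \<le> Q t0 - Q s" by blast
    \<comment> \<open>The slack makes this derivative strictly negative. A small step to the left of
      \<open>t0\<close> thus increases \<open>Q - G - \<eta> s\<close>, and by the support condition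
      \<open>\<Phi>\<close> does not decrease, so a smaller element of \<open>T\<close>
      appears.\<close>
    have "((\<lambda>s. Q s - G s - \<eta> * s) has_real_derivative (D - g t0 - \<eta>)) (at t0 within {0..1})"
      by (auto intro!: derivative_eq_intros Q G t0)
    from has_real_derivative_neg_dec_left[OF this] D \<eta> obtain d where d: "d > 0"
      and dec: "\<And>h. 0 < h \<Longrightarrow> t0 - h \<in> {0..1} \<Longrightarrow> h < d \<Longrightarrow>
        Q t0 - G t0 - \<eta> * t0 < Q (t0 - h) - G (t0 - h) - \<eta> * (t0 - h)" by auto
    define h where "h = min t0 d / 2"
    have h: "0 < h" "t0 - h \<in> {0..1}" "h < d" using pos d t0 unfolding h_def by (auto simp: min_def)
    have "\<Phi> t0 \<le> \<Phi> (t0 - h)" using dec[OF h] FQ[OF h(2)] unfolding \<Phi>_def by linarith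
    hence "t0 - h \<in> T" using h(2) t0(2) unfolding T_def by auto
    hence "t0 \<le> t0 - h" unfolding t0_def using bT by (rule cInf_lower)
    thus False using h(1) by simp
  qed
  hence "\<Phi> 1 \<le> \<Phi> 0" using t0 by simp
  thus "F 1 - F 0 \<le> G 1 - G 0 + \<eta>" unfolding \<Phi>_def by simp
qed

text \<open>The other direction is the one-sided bound for the reversed path
  \<open>s \<mapsto> 1 - s\<close>. Reversal changes the sign of \<open>D\<close>, which is why its
  absolute value is bounded.\<close>

lemma abs_increment_le_of_support:
  fixes F G g :: "real \<Rightarrow> real"
  assumes cont: "continuous_on {0..1} F"
    and G: "\<And>t. t \<in> {0..1} \<Longrightarrow> (G has_real_derivative g t) (at t within {0..1})"
    and supp: "\<And>t. t \<in> {0..1} \<Longrightarrow> \<exists>Q D. (Q has_real_derivative D) (at t within {0..1}) \<and> \<bar>D\<bar> \<le> g t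
        \<and> (\<forall>s\<in>{0..1}. F t - F s \<le> Q t - Q s)"
  shows "\<bar>F 1 - F 0\<bar> \<le> G 1 - G 0"
proof -
  have "F 1 - F 0 \<le> G 1 - G 0"
    using supp by (intro increment_le_of_left_support[OF cont G]) (auto simp: abs_le_iff, blast)
  moreover have "(\<lambda>s. F (1 - s)) 1 - (\<lambda>s. F (1 - s)) 0 \<le> (\<lambda>s. - G (1 - s)) 1 - (\<lambda>s. - G (1 - s)) 0"
  proof (rule increment_le_of_left_support)
    have im: "(\<lambda>s::real. 1 - s) ` {0..1} = {0..1}" by (auto simp: image_iff intro: bexI[of _ "1 - _"])
    have refl: "((\<lambda>s. Q (1 - s)) has_real_derivative - D) (at t within {0..1})"
      if "(Q has_real_derivative D) (at (1 - t) within {0..1})" for Q D and t :: real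
    proof -
      have "((\<lambda>s. Q (1 - s)) has_real_derivative D * (- 1)) (at t within {0..1})"
        by (rule DERIV_image_chain[where f = Q and g = "\<lambda>s. 1 - s" and s = "{0..1}", unfolded im o_def])
          (use that in \<open>auto intro!: derivative_eq_intros\<close>)
      thus ?thesis by simp
    qed
    show "continuous_on {0..1} (\<lambda>s. F (1 - s))"
      by (intro continuous_on_compose2[OF cont] continuous_intros) auto
    fix t :: real assume t: "t \<in> {0..1}"
    hence t': "1 - t \<in> {0..1}" by auto
    show "((\<lambda>s. - G (1 - s)) has_real_derivative g (1 - t)) (at t within {0..1})"
      using DERIV_minus[OF refl[OF G[OF t']]] by simp
    from supp[OF t'] obtain Q D where "(Q has_real_derivative D) (at (1 - t) within {0..1})"
      "\<bar>D\<bar> \<le> g (1 - t)" "\<forall>s\<in>{0..1}. F (1 - t) - F s \<le> Q (1 - t) - Q s" by blast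
    thus "\<exists>Q D. (Q has_real_derivative D) (at t within {0..1}) \<and> D \<le> g (1 - t)
        \<and> (\<forall>s\<in>{0..1}. F (1 - t) - F (1 - s) \<le> Q t - Q s)"
      by (intro exI[of _ "\<lambda>s. Q (1 - s)"] exI[of _ "- D"]) (auto intro: refl)
  qed
  ultimately show ?thesis by simp
qed

section \<open>Entropy along a path of density matrices\<close>

text \<open>\<open>u p i\<close> is entry \<open>i\<close> of vector number \<open>p\<close>. The
  clauses are orthonormality and completeness, that is \<open>U* U = 1\<close> and
  \<open>U U* = 1\<close> for the matrix \<open>U\<close> with these columns.\<close>

definition orthonormal_basis :: "nat \<Rightarrow> (nat \<Rightarrow> nat \<Rightarrow> complex) \<Rightarrow> bool" where
  "orthonormal_basis d u \<longleftrightarrow>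
     (\<forall>p<d. \<forall>q<d. inner_on {..<d} (u p) (u q) = of_bool (p = q)) \<and>
     (\<forall>i<d. \<forall>j<d. (\<Sum>p<d. u p i * cnj (u p j)) = of_bool (i = j))"

definition diagonalises ::
    "nat \<Rightarrow> (nat \<Rightarrow> nat \<Rightarrow> complex) \<Rightarrow> (nat \<Rightarrow> nat \<Rightarrow> complex) \<Rightarrow> (nat \<Rightarrow> real) \<Rightarrow> bool" where
  "diagonalises d r u e \<longleftrightarrow> orthonormal_basis d u \<and>
     (\<forall>i<d. \<forall>j<d. r i j = (\<Sum>p<d. u p i * complex_of_real (e p) * cnj (u p j)))"

definition quad_form :: "nat \<Rightarrow> (nat \<Rightarrow> nat \<Rightarrow> complex) \<Rightarrow> (nat \<Rightarrow> complex) \<Rightarrow> real" where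
  "quad_form d r v = Re (\<Sum>i<d. \<Sum>j<d. cnj (v i) * r i j * v j)"

lemma conjugated_diag_index:
  assumes "U \<in> carrier_mat d d" "i < d" "j < d"
  shows "(U * mat_diag d f * mat_adjoint U) $$ (i, j) = (\<Sum>p<d. U $$ (i, p) * f p * cnj (U $$ (j, p)))"
proof -
  have "(U * mat_diag d f * mat_adjoint U) $$ (i, j) = (\<Sum>p<d. (U * mat_diag d f) $$ (i, p) * mat_adjoint U $$ (p, j))"
    using assms by (intro mat_mult_index_sum) (auto intro: adjoint_carrier)
  also have "\<dots> = (\<Sum>p<d. U $$ (i, p) * f p * cnj (U $$ (j, p)))"
    unfolding mat_diag_mult_right[OF assms(1)] using assms by (intro sum.cong refl) (simp add: adjoint_index)
  finally show ?thesis .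
qed

lemma orthonormal_basis_iff_unitary:
  "orthonormal_basis d u \<longleftrightarrow> unitary d (Matrix.mat d d (\<lambda>(i, p). u p i))"
proof -
  define U where "U = Matrix.mat d d (\<lambda>(i, p). u p i)"
  have c: "U \<in> carrier_mat d d" "mat_adjoint U \<in> carrier_mat d d"
    unfolding U_def by (auto intro: adjoint_carrier)
  have U_idx: "i < d \<Longrightarrow> p < d \<Longrightarrow> U $$ (i, p) = u p i" for i p unfolding U_def by simp
  have Ua_idx: "i < d \<Longrightarrow> p < d \<Longrightarrow> mat_adjoint U $$ (p, i) = cnj (u p i)" for i p
    using c(1) by (simp add: adjoint_index U_idx)
  have one: "M = 1\<^sub>m d \<longleftrightarrow> (\<forall>i<d. \<forall>j<d. M $$ (i, j) = of_bool (i = j))"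
    if "M \<in> carrier_mat d d" for M :: "complex mat"
    using that by (auto intro!: eq_matI)
  have "(mat_adjoint U * U) $$ (p, q) = inner_on {..<d} (u p) (u q)" if "p < d" "q < d" for p q
    unfolding mat_mult_index_sum[OF c(2,1) that] inner_on_def using that
    by (intro sum.cong refl) (simp add: U_idx Ua_idx)
  hence 1: "mat_adjoint U * U = 1\<^sub>m d \<longleftrightarrow> (\<forall>p<d. \<forall>q<d. inner_on {..<d} (u p) (u q) = of_bool (p = q))"
    unfolding one[OF mult_carrier_mat[OF c(2,1)]] by metis
  have "(U * mat_adjoint U) $$ (i, j) = (\<Sum>p<d. u p i * cnj (u p j))" if "i < d" "j < d" for i j
    unfolding mat_mult_index_sum[OF c that] using that by (intro sum.cong refl) (simp add: U_idx Ua_idx)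
  hence 2: "U * mat_adjoint U = 1\<^sub>m d \<longleftrightarrow> (\<forall>i<d. \<forall>j<d. (\<Sum>p<d. u p i * cnj (u p j)) = of_bool (i = j))"
    unfolding one[OF mult_carrier_mat[OF c]] by metis
  show ?thesis unfolding orthonormal_basis_def unitary_def U_def[symmetric] 1 2 using c by blast
qed

lemma hermitian_diagonalises:
  assumes "\<And>i j. i < d \<Longrightarrow> j < d \<Longrightarrow> r i j = cnj (r j i)"
  shows "\<exists>u e. diagonalises d r u e"
proof -
  let ?A = "Matrix.mat d d (\<lambda>(i, j). r i j)"
  have "mat_adjoint ?A = ?A" by (rule eq_matI) (auto simp: adjoint_index assms[symmetric])
  from hermitian_diagonalisation[of ?A d, OF _ this] obtain U e where U: "unitary d U"
    and A: "?A = U * mat_diag d (\<lambda>i. complex_of_real (e i)) * mat_adjoint U" by auto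
  have Uc: "U \<in> carrier_mat d d" using U unfolding unitary_def by simp
  have "Matrix.mat d d (\<lambda>(i, p). U $$ (i, p)) = U" using Uc by (intro eq_matI) auto
  hence "orthonormal_basis d (\<lambda>p i. U $$ (i, p))" unfolding orthonormal_basis_iff_unitary using U by simp
  moreover have "r i j = (\<Sum>p<d. U $$ (i, p) * complex_of_real (e p) * cnj (U $$ (j, p)))"
    if "i < d" "j < d" for i j
  proof -
    have "r i j = ?A $$ (i, j)" using that by simp
    thus ?thesis unfolding A conjugated_diag_index[OF Uc that] .
  qed
  ultimately show ?thesis unfolding diagonalises_def
    by (intro exI[of _ "\<lambda>p i. U $$ (i, p)"] exI[of _ e]) simp
qed

text \<open>Connects eigenvalues with \<open>entanglement_entropy\<close>: for a reduced state and
  \<open>f = ln\<close> the right-hand side is minus the entropy.\<close>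

lemma matrix_trace_mult_herm_fun:
  assumes A: "A \<in> carrier_mat d d" and diag: "diagonalises d (\<lambda>i j. A $$ (i, j)) u e"
  shows "matrix_trace (A * herm_fun f A) = complex_of_real (\<Sum>p<d. e p * f (e p))"
proof -
  define U where "U = Matrix.mat d d (\<lambda>(i, p). u p i)"
  have U: "unitary d U" using diag unfolding diagonalises_def orthonormal_basis_iff_unitary U_def by simp
  have Uc: "U \<in> carrier_mat d d" "mat_adjoint U \<in> carrier_mat d d" and UU: "mat_adjoint U * U = 1\<^sub>m d"
    using U unfolding unitary_def by (auto intro: adjoint_carrier)
  let ?D = "\<lambda>f. mat_diag d (\<lambda>i. complex_of_real (f i))"
  have A_eq: "A = U * ?D e * mat_adjoint U"
  proof (rule eq_matI)
    fix i j assume "i < dim_row (U * ?D e * mat_adjoint U)" "j < dim_col (U * ?D e * mat_adjoint U)"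
    hence ij: "i < d" "j < d" using Uc by auto
    show "A $$ (i, j) = (U * ?D e * mat_adjoint U) $$ (i, j)"
      unfolding conjugated_diag_index[OF Uc(1) ij] using diag ij unfolding diagonalises_def U_def by simp
  qed (use A Uc in auto)
  note as = assoc_mult_mat[of _ d d _ d _ d]
  note mc = mult_carrier_mat[of _ d d _ d]
  have "A * herm_fun f A = U * ?D e * (mat_adjoint U * U) * (?D (\<lambda>i. f (e i)) * mat_adjoint U)"
    unfolding herm_fun_eq[OF U A_eq] using Uc by (subst A_eq) (simp add: as mc)
  also have "\<dots> = U * (?D e * ?D (\<lambda>i. f (e i))) * mat_adjoint U"
    unfolding UU using Uc by (simp add: as mc left_mult_one_mat[of _ d d] del: mat_diag_diag)
  finally have AB: "A * herm_fun f A = U * ?D (\<lambda>i. e i * f (e i)) * mat_adjoint U" by simp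
  have "matrix_trace (A * herm_fun f A) = (\<Sum>i<d. (U * ?D (\<lambda>i. e i * f (e i)) * mat_adjoint U) $$ (i, i))"
    unfolding matrix_trace_def AB using Uc by simp
  also have "\<dots> = (\<Sum>i<d. \<Sum>p<d. U $$ (i, p) * complex_of_real (e p * f (e p)) * cnj (U $$ (i, p)))"
    by (intro sum.cong refl conjugated_diag_index[OF Uc(1)]) auto
  also have "\<dots> = (\<Sum>p<d. complex_of_real (e p * f (e p)) * inner_on {..<d} (u p) (u p))"
    unfolding inner_on_def sum_distrib_left
    by (subst sum.swap, intro sum.cong refl) (simp add: U_def)
  also have "\<dots> = complex_of_real (\<Sum>p<d. e p * f (e p))"
    using diag unfolding diagonalises_def orthonormal_basis_def of_real_sum by (intro sum.cong refl) auto
  finally show ?thesis .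
qed

section \<open>Parseval's identity, quadratic forms and Klein's inequality\<close>

lemma parseval:
  assumes "orthonormal_basis d u"
  shows "(\<Sum>p<d. (cmod (inner_on {..<d} (u p) v))\<^sup>2) = (\<Sum>i<d. (cmod (v i))\<^sup>2)"
proof -
  have "complex_of_real (\<Sum>p<d. (cmod (inner_on {..<d} (u p) v))\<^sup>2)
      = (\<Sum>p<d. \<Sum>i<d. \<Sum>j<d. (v i * cnj (v j)) * (u p j * cnj (u p i)))"
    unfolding of_real_sum complex_norm_square inner_on_def cnj_sum sum_product
    by (intro sum.cong refl) (simp add: mult_ac)
  also have "\<dots> = (\<Sum>i<d. \<Sum>j<d. \<Sum>p<d. (v i * cnj (v j)) * (u p j * cnj (u p i)))"
    by (subst sum.swap, rule sum.cong[OF refl], rule sum.swap)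
  also have "\<dots> = (\<Sum>i<d. \<Sum>j<d. (v i * cnj (v j)) * of_bool (j = i))"
    using assms unfolding orthonormal_basis_def sum_distrib_left[symmetric] by (intro sum.cong refl) auto
  also have "\<dots> = complex_of_real (\<Sum>i<d. (cmod (v i))\<^sup>2)"
    unfolding of_real_sum complex_norm_square by (intro sum.cong refl) (simp add: sum_mult_of_bool_eq)
  finally show ?thesis unfolding of_real_eq_iff .
qed

lemma orthonormal_basis_norm:
  assumes "orthonormal_basis d u" "p < d"
  shows "(\<Sum>i<d. (cmod (u p i))\<^sup>2) = 1"
proof -
  have "complex_of_real (\<Sum>i<d. (cmod (u p i))\<^sup>2) = 1"
    using assms unfolding inner_on_self[symmetric] orthonormal_basis_def by simp
  thus ?thesis by (metis of_real_eq_1_iff)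
qed

lemma quad_form_diagonalises:
  assumes "diagonalises d r u e"
  shows "quad_form d r v = (\<Sum>p<d. e p * (cmod (inner_on {..<d} (u p) v))\<^sup>2)"
proof -
  have "(\<Sum>i<d. \<Sum>j<d. cnj (v i) * r i j * v j)
      = (\<Sum>i<d. \<Sum>j<d. \<Sum>p<d. cnj (v i) * (u p i * complex_of_real (e p) * cnj (u p j)) * v j)"
    using assms unfolding diagonalises_def by (intro sum.cong refl) (simp add: sum_distrib_left sum_distrib_right)
  also have "\<dots> = (\<Sum>i<d. \<Sum>p<d. \<Sum>j<d. complex_of_real (e p) * ((cnj (v i) * u p i) * (cnj (u p j) * v j)))"
    by (rule sum.cong[OF refl], subst sum.swap) (simp add: mult_ac)
  also have "\<dots> = (\<Sum>p<d. \<Sum>i<d. \<Sum>j<d. complex_of_real (e p) * ((cnj (v i) * u p i) * (cnj (u p j) * v j)))"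
    by (rule sum.swap)
  also have "\<dots> = (\<Sum>p<d. complex_of_real (e p) * (inner_on {..<d} v (u p) * inner_on {..<d} (u p) v))"
    unfolding inner_on_def sum_product by (simp only: sum_distrib_left)
  also have "\<dots> = complex_of_real (\<Sum>p<d. e p * (cmod (inner_on {..<d} (u p) v))\<^sup>2)"
    unfolding of_real_sum of_real_mult complex_norm_square inner_on_cnj by (simp add: mult_ac)
  finally show ?thesis unfolding quad_form_def by simp
qed

lemma quad_form_eigenvector:
  assumes "diagonalises d r u e" "p < d"
  shows "quad_form d r (u p) = e p"
proof -
  have "quad_form d r (u p) = (\<Sum>q<d. e q * of_bool (q = p))"
    unfolding quad_form_diagonalises[OF assms(1)] using assms unfolding diagonalises_def orthonormal_basis_def
    by (intro sum.cong refl) auto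
  thus ?thesis using assms(2) by (simp add: sum_mult_of_bool_eq)
qed

text \<open>The overlaps \<open>W p q\<close> of two orthonormal bases form a doubly stochastic
  matrix. Averaging the scalar tangent inequality over it gives the inequality for matrices: the row
  sums produce \<open>f (e p)\<close> and the diagonal of \<open>r'\<close> in the eigenbasis of
  \<open>r\<close>, the column sums produce \<open>f (e' q)\<close>. The bound is affine in
  \<open>r'\<close>, hence differentiable along a smooth path even where eigenvalues cross.\<close>

lemma klein_inequality:
  assumes r: "diagonalises d r u e" and r': "diagonalises d r' v e'"
    and supp: "\<And>p q. p < d \<Longrightarrow> q < d \<Longrightarrow> f (e p) + c p * (e' q - e p) \<le> f (e' q)"
  shows "(\<Sum>p<d. f (e p)) - (\<Sum>p<d. f (e' p))
    \<le> (\<Sum>p<d. c p * quad_form d r (u p)) - (\<Sum>p<d. c p * quad_form d r' (u p))"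
proof -
  define W where "W p q = (cmod (inner_on {..<d} (v q) (u p)))\<^sup>2" for p q
  have onb: "orthonormal_basis d u" "orthonormal_basis d v" using r r' unfolding diagonalises_def by auto
  have row: "(\<Sum>q<d. W p q) = 1" if "p < d" for p
    unfolding W_def parseval[OF onb(2)] by (rule orthonormal_basis_norm[OF onb(1) that])
  have "W p q = (cmod (inner_on {..<d} (u p) (v q)))\<^sup>2" for p q
    unfolding W_def by (metis complex_mod_cnj inner_on_cnj)
  hence col: "(\<Sum>p<d. W p q) = 1" if "q < d" for q
    using parseval[OF onb(1), of "v q"] orthonormal_basis_norm[OF onb(2) that] by simp
  have "(\<Sum>p<d. f (e p) + c p * (quad_form d r' (u p) - e p))
      = (\<Sum>p<d. (f (e p) - c p * e p) * (\<Sum>q<d. W p q) + c p * (\<Sum>q<d. e' q * W p q))"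
    unfolding quad_form_diagonalises[OF r'] W_def[symmetric]
    by (intro sum.cong refl) (simp add: row algebra_simps)
  also have "\<dots> = (\<Sum>p<d. \<Sum>q<d. W p q * (f (e p) + c p * (e' q - e p)))"
    unfolding sum_distrib_left sum.distrib[symmetric] by (intro sum.cong refl) (simp add: algebra_simps)
  also have "\<dots> \<le> (\<Sum>p<d. \<Sum>q<d. W p q * f (e' q))"
    by (intro sum_mono mult_left_mono supp) (auto simp: W_def)
  also have "\<dots> = (\<Sum>q<d. f (e' q) * (\<Sum>p<d. W p q))"
    unfolding sum_distrib_left by (subst sum.swap) (simp add: mult.commute)
  also have "\<dots> = (\<Sum>q<d. f (e' q))" by (simp add: col)
  finally show ?thesis
    by (simp add: sum.distrib sum_subtractf right_diff_distrib quad_form_eigenvector[OF r])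
qed

text \<open>A crude Lipschitz bound; it serves to show that the regularised entropy is continuous
  along the path.\<close>

lemma quad_form_diff_le:
  assumes "\<And>i. i < d \<Longrightarrow> cmod (v i) \<le> 1"
  shows "\<bar>quad_form d r v - quad_form d r' v\<bar> \<le> (\<Sum>i<d. \<Sum>j<d. cmod (r i j - r' i j))"
proof -
  have "quad_form d r v - quad_form d r' v = Re (\<Sum>i<d. \<Sum>j<d. cnj (v i) * (r i j - r' i j) * v j)"
    unfolding quad_form_def by (simp add: algebra_simps sum_subtractf)
  also have "\<bar>\<dots>\<bar> \<le> cmod (\<Sum>i<d. \<Sum>j<d. cnj (v i) * (r i j - r' i j) * v j)" by (rule abs_Re_le_cmod)
  also have "\<dots> \<le> (\<Sum>i<d. \<Sum>j<d. cmod (cnj (v i) * (r i j - r' i j) * v j))"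
    by (intro order.trans[OF norm_sum] sum_mono norm_sum)
  also have "\<dots> \<le> (\<Sum>i<d. \<Sum>j<d. cmod (r i j - r' i j))"
  proof (intro sum_mono)
    fix i j assume "i \<in> {..<d}" "j \<in> {..<d}"
    hence "cmod (v i) * cmod (r i j - r' i j) * cmod (v j) \<le> 1 * cmod (r i j - r' i j) * 1"
      using assms by (intro mult_mono) auto
    thus "cmod (cnj (v i) * (r i j - r' i j) * v j) \<le> cmod (r i j - r' i j)" by (simp add: norm_mult)
  qed
  finally show ?thesis .
qed

section \<open>Scalar inequalities for the logarithm and removal of the regularisation\<close>

lemma neg_entropy_tangent:
  fixes x y \<epsilon> :: real
  assumes "\<epsilon> > 0" "x \<ge> 0" "y \<ge> 0"
  shows "(x + \<epsilon>) * ln (x + \<epsilon>) + (ln (x + \<epsilon>) + 1) * (y - x) \<le> (y + \<epsilon>) * ln (y + \<epsilon>)"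
proof -
  define a b where "a = x + \<epsilon>" and "b = y + \<epsilon>"
  have ab: "a > 0" "b > 0" using assms unfolding a_def b_def by auto
  \<comment> \<open>Convexity of \<open>x ln x\<close> in its tangent form is
    \<open>ln y \<le> y - 1\<close> at \<open>y = a / b\<close>, multiplied by \<open>b\<close>. The
    shift by \<open>\<epsilon>\<close> keeps the slope \<open>ln a + 1\<close> meaningful at
    \<open>x = 0\<close>.\<close>
  have "ln (a / b) \<le> a / b - 1" using ab by (intro ln_le_minus_one) auto
  hence "b * (ln a - ln b) \<le> b * (a / b - 1)" using ab by (intro mult_left_mono) (auto simp: ln_div)
  also have "\<dots> = a - b" using ab by (simp add: field_simps)
  finally have "a * ln a + (ln a + 1) * (b - a) \<le> b * ln b" by (simp add: algebra_simps)
  thus ?thesis unfolding a_def b_def by simp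
qed

text \<open>Both sides vanish at \<open>t = 1\<close>, and right minus left has the derivative
  \<open>(1 - 1 / t)^2\<close>.\<close>

lemma two_ln_le:
  fixes t :: real
  assumes "t \<ge> 1"
  shows "2 * ln t \<le> t - 1 / t"
proof -
  have "(1 - 1 / 1) - 2 * ln 1 \<le> (t - 1 / t) - 2 * ln t"
  proof (rule DERIV_nonneg_imp_nondecreasing[OF assms])
    fix x :: real assume x: "1 \<le> x" "x \<le> t"
    have "((\<lambda>x. (x - 1 / x) - 2 * ln x) has_real_derivative (1 - 1 / x)\<^sup>2) (at x)"
      using x by (auto intro!: derivative_eq_intros simp: field_simps power2_eq_square)
    thus "\<exists>y. ((\<lambda>x. (x - 1 / x) - 2 * ln x) has_real_derivative y) (at x) \<and> 0 \<le> y" by auto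
  qed
  thus ?thesis by simp
qed

text \<open>The geometric mean is at most the logarithmic mean
  \<open>(u - v) / (ln u - ln v)\<close>. For \<open>0 < v \<le> u\<close> the shift only brings the
  ratio closer to 1, and \<open>t = sqrt (u / v)\<close> reduces the claim to
  \<open>two_ln_le\<close>.\<close>

lemma sqrt_mult_ln_diff_le:
  fixes u v \<epsilon> :: real
  assumes "\<epsilon> > 0" "u \<ge> 0" "v \<ge> 0"
  shows "sqrt (u * v) * \<bar>ln (u + \<epsilon>) - ln (v + \<epsilon>)\<bar> \<le> \<bar>u - v\<bar>"
proof -
  have *: "sqrt (u * v) * (ln (u + \<epsilon>) - ln (v + \<epsilon>)) \<le> u - v" if vu: "v \<le> u" and v: "0 \<le> v" for u v
  proof (cases "v = 0")
    case True
    thus ?thesis using vu by simp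
  next
    case False
    hence pos: "v > 0" "u > 0" using vu v by auto
    define t where "t = sqrt (u / v)"
    have t: "t \<ge> 1" unfolding t_def using pos vu by simp
    have "ln (u + \<epsilon>) - ln (v + \<epsilon>) \<le> ln u - ln v"
    proof -
      have "(u + \<epsilon>) * v \<le> u * (v + \<epsilon>)" using vu assms(1) by (simp add: algebra_simps mult_left_mono)
      hence "ln ((u + \<epsilon>) * v) \<le> ln (u * (v + \<epsilon>))" using pos assms(1) by (subst ln_le_cancel_iff) auto
      thus ?thesis using pos assms(1) by (simp add: ln_mult)
    qed
    also have "\<dots> = 2 * ln t" unfolding t_def using pos by (simp add: ln_sqrt ln_div)
    also have "\<dots> \<le> t - 1 / t" using two_ln_le[OF t] .
    finally have "sqrt (u * v) * (ln (u + \<epsilon>) - ln (v + \<epsilon>)) \<le> sqrt (u * v) * (t - 1 / t)"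
      using pos by (intro mult_left_mono) auto
    also have "\<dots> = u - v"
    proof -
      have "sqrt (u * v) * t = u" "sqrt (u * v) / t = v"
        unfolding t_def using pos
        by (simp_all add: real_sqrt_mult[symmetric] real_sqrt_divide[symmetric] power2_eq_square[symmetric])
      thus ?thesis by (simp add: right_diff_distrib)
    qed
    finally show ?thesis .
  qed
  show ?thesis
  proof (cases "v \<le> u")
    case True
    moreover have "ln (v + \<epsilon>) \<le> ln (u + \<epsilon>)" using True assms by simp
    ultimately show ?thesis using *[OF True assms(3)] by simp
  next
    case False
    hence uv: "u \<le> v" by simp
    moreover have "ln (u + \<epsilon>) \<le> ln (v + \<epsilon>)" using uv assms by simp
    ultimately show ?thesis using *[OF uv assms(2)] by (simp add: mult.commute)
  qed
qed

lemma tendsto_mult_ln_at_right_0: "((\<lambda>x::real. x * ln x) \<longlongrightarrow> 0) (at_right 0)"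
proof -
  have "((\<lambda>x::real. - (ln x / x)) \<longlongrightarrow> - 0) at_top"
    by (intro tendsto_minus ln_x_over_x_tendsto_0)
  moreover have "eventually (\<lambda>x::real. - (ln x / x) = inverse x * ln (inverse x)) at_top"
    using eventually_gt_at_top[of 0] by eventually_elim (simp add: ln_inverse divide_inverse mult.commute)
  ultimately have "((\<lambda>x::real. inverse x * ln (inverse x)) \<longlongrightarrow> 0) at_top"
    by (simp add: filterlim_cong)
  thus ?thesis by (subst filterlim_at_right_to_top)
qed

lemma tendsto_shifted_mult_ln:
  fixes x :: real
  assumes "x \<ge> 0"
  shows "((\<lambda>\<epsilon>. (x + \<epsilon>) * ln (x + \<epsilon>)) \<longlongrightarrow> x * ln x) (at_right 0)"
proof (cases "x = 0")
  case True
  \<comment> \<open>The limit 0 agrees with the value \<open>0 * ln 0 = 0\<close>.\<close>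
  thus ?thesis using tendsto_mult_ln_at_right_0 by simp
next
  case False
  have "((\<lambda>\<epsilon>. (x + \<epsilon>) * ln (x + \<epsilon>)) \<longlongrightarrow> (x + 0) * ln (x + 0)) (at_right 0)"
    using False assms by (intro tendsto_intros) auto
  thus ?thesis by simp
qed

text \<open>Klein's inequality at time \<open>t\<close>, with the tangent slopes
  \<open>c t p = ln (e t p + \<epsilon>) + 1\<close> and the eigenbasis frozen at \<open>t\<close>,
  supplies the support function. By \<open>sqrt_mult_ln_diff_le\<close> these slopes meet the
  condition under which \<open>rate\<close> bounds the derivative.\<close>

lemma regularised_entropy_increment:
  fixes r :: "real \<Rightarrow> nat \<Rightarrow> nat \<Rightarrow> complex" and e :: "real \<Rightarrow> nat \<Rightarrow> real" and \<epsilon> :: real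
  assumes \<epsilon>: "\<epsilon> > 0"
    and diag: "\<And>s. s \<in> {0..1} \<Longrightarrow> diagonalises d (r s) (u s) (e s)"
    and e01: "\<And>s p. s \<in> {0..1} \<Longrightarrow> p < d \<Longrightarrow> e s p \<in> {0..1}"
    and cont: "\<And>i j. i < d \<Longrightarrow> j < d \<Longrightarrow> continuous_on {0..1} (\<lambda>s. r s i j)"
    and G: "\<And>t. t \<in> {0..1} \<Longrightarrow> (G has_real_derivative g t) (at t within {0..1})"
    and rate: "\<And>t c. t \<in> {0..1} \<Longrightarrow>
      (\<And>p q. p < d \<Longrightarrow> q < d \<Longrightarrow> sqrt (e t p * e t q) * \<bar>c p - c q\<bar> \<le> \<bar>e t p - e t q\<bar>) \<Longrightarrow>
      \<exists>D. ((\<lambda>s. \<Sum>p<d. c p * quad_form d (r s) (u t p)) has_real_derivative D) (at t within {0..1})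
        \<and> \<bar>D\<bar> \<le> g t"
  shows "\<bar>(\<Sum>p<d. (e 1 p + \<epsilon>) * ln (e 1 p + \<epsilon>)) - (\<Sum>p<d. (e 0 p + \<epsilon>) * ln (e 0 p + \<epsilon>))\<bar> \<le> G 1 - G 0"
proof -
  define F where "F s = (\<Sum>p<d. (e s p + \<epsilon>) * ln (e s p + \<epsilon>))" for s
  define c where "c t p = ln (e t p + \<epsilon>) + 1" for t p
  have klein: "F t - F s \<le> (\<Sum>p<d. c t p * quad_form d (r t) (u t p)) - (\<Sum>p<d. c t p * quad_form d (r s) (u t p))"
    if "t \<in> {0..1}" "s \<in> {0..1}" for s t
    unfolding F_def c_def using that e01 \<epsilon>
    by (intro klein_inequality[OF diag[OF that(1)] diag[OF that(2)], where f = "\<lambda>x. (x + \<epsilon>) * ln (x + \<epsilon>)"]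
        neg_entropy_tangent) auto
  define M where "M = \<bar>ln \<epsilon>\<bar> + \<bar>ln (1 + \<epsilon>)\<bar> + 1"
  define \<Delta> where "\<Delta> s t = (\<Sum>i<d. \<Sum>j<d. cmod (r s i j - r t i j))" for s t
  have c_le: "\<bar>c t p\<bar> \<le> M" if "t \<in> {0..1}" "p < d" for t p
  proof -
    have "ln \<epsilon> \<le> ln (e t p + \<epsilon>)" "ln (e t p + \<epsilon>) \<le> ln (1 + \<epsilon>)" using e01[OF that] \<epsilon> by auto
    thus ?thesis unfolding c_def M_def by linarith
  qed
  have lip1: "F t - F s \<le> d * M * \<Delta> t s" if st: "t \<in> {0..1}" "s \<in> {0..1}" for s t
  proof -
    have onb: "orthonormal_basis d (u t)" using diag[OF st(1)] unfolding diagonalises_def by simp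
    have u1: "cmod (u t p i) \<le> 1" if "p < d" "i < d" for p i
    proof -
      have "(cmod (u t p i))\<^sup>2 \<le> (\<Sum>i<d. (cmod (u t p i))\<^sup>2)" using that by (intro member_le_sum) auto
      thus ?thesis unfolding orthonormal_basis_norm[OF onb that(1)] by (simp add: power_le_one_iff abs_square_le_1)
    qed
    have "F t - F s \<le> (\<Sum>p<d. c t p * (quad_form d (r t) (u t p) - quad_form d (r s) (u t p)))"
      using klein[OF st] by (simp add: right_diff_distrib sum_subtractf)
    also have "\<dots> \<le> (\<Sum>p<d. M * \<Delta> t s)"
    proof (intro sum_mono)
      fix p assume "p \<in> {..<d}"
      hence p: "p < d" by simp
      have "c t p * (quad_form d (r t) (u t p) - quad_form d (r s) (u t p))
          \<le> \<bar>c t p\<bar> * \<bar>quad_form d (r t) (u t p) - quad_form d (r s) (u t p)\<bar>"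
        by (metis abs_ge_self abs_mult)
      also have "\<dots> \<le> M * \<Delta> t s"
        unfolding \<Delta>_def using c_le[OF st(1) p] u1[OF p] by (intro mult_mono quad_form_diff_le) (auto simp: M_def)
      finally show "c t p * (quad_form d (r t) (u t p) - quad_form d (r s) (u t p)) \<le> M * \<Delta> t s" .
    qed
    finally show ?thesis by simp
  qed
  have \<Delta>_sym: "\<Delta> s t = \<Delta> t s" for s t unfolding \<Delta>_def by (simp add: norm_minus_commute)
  \<comment> \<open>The bases \<open>u t\<close> and eigenvalues \<open>e t\<close> carry no assumed
    regularity in \<open>t\<close>. Klein's inequality in both directions bounds increments of
    \<open>F\<close> by those of the matrix entries, which are continuous.\<close>
  have contF: "continuous_on {0..1} F"
    unfolding continuous_on_def
  proof
    fix t :: real assume t: "t \<in> {0..1}"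
    have "((\<lambda>s. d * M * \<Delta> s t) \<longlongrightarrow> d * M * \<Delta> t t) (at t within {0..1})"
      unfolding \<Delta>_def using cont t by (intro tendsto_intros) (auto simp: continuous_on_def)
    hence "((\<lambda>s. d * M * \<Delta> s t) \<longlongrightarrow> 0) (at t within {0..1})" unfolding \<Delta>_def by simp
    moreover have "norm (F s - F t) \<le> d * M * \<Delta> s t" if "s \<in> {0..1}" for s
      using lip1[OF t that] lip1[OF that t] \<Delta>_sym[of s t] by (simp add: abs_le_iff)
    hence "eventually (\<lambda>s. norm (F s - F t) \<le> d * M * \<Delta> s t) (at t within {0..1})"
      unfolding eventually_at_filter by simp
    ultimately have "((\<lambda>s. F s - F t) \<longlongrightarrow> 0) (at t within {0..1})" by (rule Lim_null_comparison[rotated])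
    thus "(F \<longlongrightarrow> F t) (at t within {0..1})" by (simp add: LIM_zero_iff)
  qed
  have "\<bar>F 1 - F 0\<bar> \<le> G 1 - G 0"
  proof (rule abs_increment_le_of_support[OF contF G])
    fix t :: real assume t: "t \<in> {0..1}"
    have "sqrt (e t p * e t q) * \<bar>c t p - c t q\<bar> \<le> \<bar>e t p - e t q\<bar>" if "p < d" "q < d" for p q
      using sqrt_mult_ln_diff_le[OF \<epsilon>, of "e t p" "e t q"] e01[OF t] that unfolding c_def by simp
    from rate[OF t this] obtain D where
      "((\<lambda>s. \<Sum>p<d. c t p * quad_form d (r s) (u t p)) has_real_derivative D) (at t within {0..1})" "\<bar>D\<bar> \<le> g t"
      by blast
    thus "\<exists>Q D. (Q has_real_derivative D) (at t within {0..1}) \<and> \<bar>D\<bar> \<le> g t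
        \<and> (\<forall>s\<in>{0..1}. F t - F s \<le> Q t - Q s)"
      using klein[OF t] by blast
  qed
  thus ?thesis unfolding F_def .
qed

text \<open>The bound for the regularised entropy does not depend on \<open>\<epsilon>\<close>, so
  it survives the limit \<open>\<epsilon> \<rightarrow> 0\<close>.\<close>

lemma entropy_increment:
  fixes r :: "real \<Rightarrow> nat \<Rightarrow> nat \<Rightarrow> complex" and e :: "real \<Rightarrow> nat \<Rightarrow> real"
  assumes diag: "\<And>s. s \<in> {0..1} \<Longrightarrow> diagonalises d (r s) (u s) (e s)"
    and e01: "\<And>s p. s \<in> {0..1} \<Longrightarrow> p < d \<Longrightarrow> e s p \<in> {0..1}"
    and cont: "\<And>i j. i < d \<Longrightarrow> j < d \<Longrightarrow> continuous_on {0..1} (\<lambda>s. r s i j)"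
    and G: "\<And>t. t \<in> {0..1} \<Longrightarrow> (G has_real_derivative g t) (at t within {0..1})"
    and rate: "\<And>t c. t \<in> {0..1} \<Longrightarrow>
      (\<And>p q. p < d \<Longrightarrow> q < d \<Longrightarrow> sqrt (e t p * e t q) * \<bar>c p - c q\<bar> \<le> \<bar>e t p - e t q\<bar>) \<Longrightarrow>
      \<exists>D. ((\<lambda>s. \<Sum>p<d. c p * quad_form d (r s) (u t p)) has_real_derivative D) (at t within {0..1})
        \<and> \<bar>D\<bar> \<le> g t"
  shows "\<bar>(\<Sum>p<d. e 1 p * ln (e 1 p)) - (\<Sum>p<d. e 0 p * ln (e 0 p))\<bar> \<le> G 1 - G 0"
proof (rule tendsto_upperbound)
  show "((\<lambda>\<epsilon>. \<bar>(\<Sum>p<d. (e 1 p + \<epsilon>) * ln (e 1 p + \<epsilon>)) - (\<Sum>p<d. (e 0 p + \<epsilon>) * ln (e 0 p + \<epsilon>))\<bar>)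
      \<longlongrightarrow> \<bar>(\<Sum>p<d. e 1 p * ln (e 1 p)) - (\<Sum>p<d. e 0 p * ln (e 0 p))\<bar>) (at_right 0)"
    using e01[of 0] e01[of 1] by (intro tendsto_rabs tendsto_diff tendsto_sum tendsto_shifted_mult_ln) auto
  show "eventually (\<lambda>\<epsilon>. \<bar>(\<Sum>p<d. (e 1 p + \<epsilon>) * ln (e 1 p + \<epsilon>)) - (\<Sum>p<d. (e 0 p + \<epsilon>) * ln (e 0 p + \<epsilon>))\<bar>
      \<le> G 1 - G 0) (at_right 0)"
    using eventually_at_right_less[of "0::real"]
    by (rule eventually_mono) (rule regularised_entropy_increment[OF _ diag e01 cont G rate])
qed simp

section \<open>Pauli operators\<close>

text \<open>An index of the chain splits as \<open>i * b + x\<close>, with \<open>i\<close> for the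
  qubits before the cut and \<open>x\<close> for those after it.\<close>

lemma sum_lessThan_mult:
  fixes f :: "nat \<Rightarrow> 'a :: comm_monoid_add"
  shows "(\<Sum>k<a * b. f k) = (\<Sum>i<a. \<Sum>x<b. f (i * b + x))"
proof -
  have "(\<Sum>k<a * b. f k) = (\<Sum>i<a. sum f {i * b ..< i * b + b})" by (rule sum.nat_group[symmetric])
  moreover have "sum f {i * b ..< i * b + b} = (\<Sum>x<b. f (i * b + x))" for i
    by (subst sum.atLeastLessThan_shift_0) (simp add: lessThan_atLeast0)
  ultimately show ?thesis by simp
qed

lemma mult_add_less_mult:
  fixes i x a b :: nat
  assumes "i < a" "x < b"
  shows "i * b + x < a * b"
proof -
  have "i * b + x < Suc i * b" using assms(2) by simp
  also have "\<dots> \<le> a * b" using assms(1) by (intro mult_le_mono1) simp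
  finally show ?thesis .
qed

lemma pauli_matrix_carrier: "pauli_matrix p \<in> carrier_mat 2 2"
  by (cases p) (auto simp: mat_of_rows_list_def)

lemma pauli_operator_carrier: "pauli_operator \<sigma> \<in> carrier_mat (2 ^ length \<sigma>) (2 ^ length \<sigma>)"
proof (induction \<sigma>)
  case (Cons p \<sigma>)
  thus ?case using pauli_matrix_carrier[of p] by (auto simp: kronecker_def)
qed auto

lemma pauli_operator_Cons_index:
  assumes "i < 2 * 2 ^ length \<sigma>" "j < 2 * 2 ^ length \<sigma>"
  shows "pauli_operator (p # \<sigma>) $$ (i, j)
    = pauli_matrix p $$ (i div 2 ^ length \<sigma>, j div 2 ^ length \<sigma>)
      * pauli_operator \<sigma> $$ (i mod 2 ^ length \<sigma>, j mod 2 ^ length \<sigma>)"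
  using pauli_matrix_carrier[of p] pauli_operator_carrier[of \<sigma>] assms by (simp add: kronecker_def)

text \<open>This is the product structure across a cut: splitting the string factors the operator as
  a tensor product. Removing one letter from the front reduces it to the behaviour of
  \<open>div\<close> and \<open>mod\<close> on composite indices.\<close>

lemma pauli_operator_append_index:
  assumes "i < 2 ^ length \<sigma>" "j < 2 ^ length \<sigma>" "x < 2 ^ length \<tau>" "y < 2 ^ length \<tau>"
  shows "pauli_operator (\<sigma> @ \<tau>) $$ (i * 2 ^ length \<tau> + x, j * 2 ^ length \<tau> + y)
    = pauli_operator \<sigma> $$ (i, j) * pauli_operator \<tau> $$ (x, y)"
  using assms
proof (induction \<sigma> arbitrary: i j)
  case (Cons p \<sigma>)
  let ?a = "2 ^ length \<sigma> :: nat" and ?b = "2 ^ length \<tau> :: nat"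
  have less: "k * ?b + z < 2 * 2 ^ length (\<sigma> @ \<tau>)" if "k < 2 ^ length (p # \<sigma>)" "z < ?b" for k z
    using mult_add_less_mult[OF that] by (simp add: power_add mult_ac)
  \<comment> \<open>The leading digit of the composite index is that of \<open>k\<close>; the
    remaining digits of \<open>k\<close> stay in front of \<open>z\<close>.\<close>
  have dv: "(k * ?b + z) div 2 ^ length (\<sigma> @ \<tau>) = k div ?a" if "z < ?b" for k z
    using that by (simp add: power_add mult.commute[of ?a] div_mult2_eq)
  have md: "(k * ?b + z) mod 2 ^ length (\<sigma> @ \<tau>) = (k mod ?a) * ?b + z" if "z < ?b" for k z
    using that by (simp add: power_add mult.commute[of ?a] mod_mult2_eq)
  have "pauli_operator ((p # \<sigma>) @ \<tau>) $$ (i * ?b + x, j * ?b + y)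
      = pauli_matrix p $$ (i div ?a, j div ?a)
        * pauli_operator (\<sigma> @ \<tau>) $$ ((i mod ?a) * ?b + x, (j mod ?a) * ?b + y)"
    using pauli_operator_Cons_index[OF less less, of i x j y p] Cons.prems dv md by simp
  also have "\<dots> = pauli_matrix p $$ (i div ?a, j div ?a)
      * (pauli_operator \<sigma> $$ (i mod ?a, j mod ?a) * pauli_operator \<tau> $$ (x, y))"
    using Cons.prems by (subst Cons.IH) auto
  also have "\<dots> = pauli_operator (p # \<sigma>) $$ (i, j) * pauli_operator \<tau> $$ (x, y)"
    using Cons.prems by (subst pauli_operator_Cons_index) auto
  finally show ?case .
qed auto

lemma pauli_matrix_hermitian:
  "i < 2 \<Longrightarrow> j < 2 \<Longrightarrow> pauli_matrix p $$ (i, j) = cnj (pauli_matrix p $$ (j, i))"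
  by (cases p) (auto simp: mat_of_rows_list_def less_2_cases_iff)

lemma pauli_matrix_isometric:
  assumes "i < 2" "j < 2"
  shows "(\<Sum>k<2. cnj (pauli_matrix p $$ (k, i)) * pauli_matrix p $$ (k, j)) = of_bool (i = j)"
proof -
  have "i = 0 \<or> i = 1" "j = 0 \<or> j = 1" using assms by auto
  thus ?thesis by (elim disjE; cases p) (simp_all add: mat_of_rows_list_def numeral_2_eq_2)
qed

lemma pauli_operator_hermitian:
  "i < 2 ^ length \<sigma> \<Longrightarrow> j < 2 ^ length \<sigma> \<Longrightarrow>
    pauli_operator \<sigma> $$ (i, j) = cnj (pauli_operator \<sigma> $$ (j, i))"
proof (induction \<sigma> arbitrary: i j)
  case (Cons p \<sigma>)
  hence "i div 2 ^ length \<sigma> < 2" "j div 2 ^ length \<sigma> < 2"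
    by (auto simp: less_mult_imp_div_less)
  thus ?case using Cons.prems
    by (simp only: pauli_operator_Cons_index length_Cons power_Suc complex_cnj_mult)
      (metis Cons.IH pauli_matrix_hermitian mod_less_divisor zero_less_power zero_less_numeral)
qed auto

lemma pauli_operator_isometric:
  "i < 2 ^ length \<sigma> \<Longrightarrow> j < 2 ^ length \<sigma> \<Longrightarrow>
    (\<Sum>k<2 ^ length \<sigma>. cnj (pauli_operator \<sigma> $$ (k, i)) * pauli_operator \<sigma> $$ (k, j)) = of_bool (i = j)"
proof (induction \<sigma> arbitrary: i j)
  case (Cons p \<sigma>)
  let ?a = "2 ^ length \<sigma> :: nat"
  have ij: "i < 2 * ?a" "j < 2 * ?a" using Cons.prems by auto
  have dv: "i div ?a < 2" "j div ?a < 2" using ij by (auto simp: less_mult_imp_div_less)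
  have "(\<Sum>k<2 ^ length (p # \<sigma>). cnj (pauli_operator (p # \<sigma>) $$ (k, i)) * pauli_operator (p # \<sigma>) $$ (k, j))
      = (\<Sum>q<2. \<Sum>r<?a. cnj (pauli_operator (p # \<sigma>) $$ (q * ?a + r, i)) * pauli_operator (p # \<sigma>) $$ (q * ?a + r, j))"
    by (simp only: length_Cons power_Suc sum_lessThan_mult)
  also have "\<dots> = (\<Sum>q<2. \<Sum>r<?a.
      (cnj (pauli_matrix p $$ (q, i div ?a)) * pauli_matrix p $$ (q, j div ?a))
      * (cnj (pauli_operator \<sigma> $$ (r, i mod ?a)) * pauli_operator \<sigma> $$ (r, j mod ?a)))"
  proof (intro sum.cong refl)
    fix q r assume "q \<in> {..<2::nat}" "r \<in> {..<?a}"
    hence qr: "q * ?a + r < 2 * ?a" "(q * ?a + r) div ?a = q" "(q * ?a + r) mod ?a = r"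
      using mult_add_less_mult[of q 2 r ?a] by auto
    show "cnj (pauli_operator (p # \<sigma>) $$ (q * ?a + r, i)) * pauli_operator (p # \<sigma>) $$ (q * ?a + r, j)
      = (cnj (pauli_matrix p $$ (q, i div ?a)) * pauli_matrix p $$ (q, j div ?a))
      * (cnj (pauli_operator \<sigma> $$ (r, i mod ?a)) * pauli_operator \<sigma> $$ (r, j mod ?a))"
      by (simp only: pauli_operator_Cons_index[OF qr(1) ij(1)] pauli_operator_Cons_index[OF qr(1) ij(2)]
          qr complex_cnj_mult mult_ac)
  qed
  also have "\<dots> = (\<Sum>q<2. cnj (pauli_matrix p $$ (q, i div ?a)) * pauli_matrix p $$ (q, j div ?a))
      * (\<Sum>r<?a. cnj (pauli_operator \<sigma> $$ (r, i mod ?a)) * pauli_operator \<sigma> $$ (r, j mod ?a))"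
    by (simp add: sum_product)
  also have "\<dots> = of_bool (i div ?a = j div ?a) * of_bool (i mod ?a = j mod ?a)"
    using dv by (simp add: pauli_matrix_isometric Cons.IH)
  also have "\<dots> = of_bool (i div ?a = j div ?a \<and> i mod ?a = j mod ?a)"
    by (rule of_bool_conj[symmetric])
  also have "(i div ?a = j div ?a \<and> i mod ?a = j mod ?a) \<longleftrightarrow> i = j"
    by (metis div_mult_mod_eq)
  finally show ?case .
qed auto

section \<open>Projections of rank one\<close>

text \<open>A maximal independent set of columns has a single element \<open>v\<close>. By
  maximality every column is a multiple of \<open>v\<close>, and \<open>w\<close> collects the
  factors.\<close>

lemma rank_one_outer:
  fixes A :: "complex mat"
  assumes A: "A \<in> carrier_mat n nc" and r: "vec_space.rank n A = 1"
  shows "\<exists>v w. v \<in> set (cols A) \<and> v \<noteq> 0\<^sub>v n \<and> (\<forall>i<n. \<forall>j<nc. A $$ (i, j) = vec_index v i * w j)"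
proof -
  interpret vec_space "TYPE(complex)" n .
  obtain S where S: "maximal S (\<lambda>T. T \<subseteq> set (cols A) \<and> lin_indpt T)"
    using maximal_exists_superset[of "set (cols A)" "\<lambda>T. T \<subseteq> set (cols A) \<and> lin_indpt T" "{}"]
    by (auto simp: lin_dep_def)
  have colsV: "set (cols A) \<subseteq> carrier_vec n" using cols_dim A by blast
  have "card S = 1" using rank_card_indpt[OF A S] r by simp
  then obtain v where Sv: "S = {v}" by (auto simp: card_1_singleton_iff)
  have v: "v \<in> set (cols A)" "lin_indpt {v}" using S unfolding maximal_def Sv by auto
  have vV: "v \<in> carrier_vec n" using v colsV by auto
  have v0: "v \<noteq> 0\<^sub>v n" using v(2) zero_nin_lin_indpt[of "{v}"] vV by auto
  have "\<exists>a. c = a \<cdot>\<^sub>v v" if c: "c \<in> set (cols A)" for c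
  proof -
    have "c \<in> span {v}"
    proof (cases "c = v")
      case True
      show ?thesis unfolding True by (rule span_self[OF vV])
    next
      case False
      have "lin_dep ({v} \<union> {c})"
      proof (rule ccontr)
        assume "\<not> lin_dep ({v} \<union> {c})"
        moreover have "{v} \<union> {c} \<subseteq> set (cols A)" "{v} \<subseteq> {v} \<union> {c}" using v(1) c by auto
        ultimately have "{v} \<union> {c} = {v}" using S unfolding maximal_def Sv by metis
        thus False using False by auto
      qed
      moreover have "{v} \<subseteq> carrier_vec n" "c \<in> carrier_vec n" "c \<notin> {v}" using vV c colsV False by auto
      ultimately show ?thesis using lin_dep_iff_in_span[of "{v}" c] v(2) by blast
    qed
    moreover have "span {v} = {lincomb a {v} | a. a \<in> {v} \<rightarrow> UNIV}"
      using finite_span[of "{v}"] vV by simp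
    ultimately obtain a where "c = lincomb a {v}" by blast
    thus ?thesis using vV by (simp add: lincomb_def) blast
  qed
  hence "\<exists>a. \<forall>j<nc. col A j = a j \<cdot>\<^sub>v v"
    using A by (intro choice allI) (metis carrier_matD(2) cols_length cols_nth nth_mem)
  then obtain w where w: "\<And>j. j < nc \<Longrightarrow> col A j = w j \<cdot>\<^sub>v v" by blast
  have "A $$ (i, j) = vec_index v i * w j" if "i < n" "j < nc" for i j
  proof -
    have "A $$ (i, j) = vec_index (col A j) i" using A that by simp
    thus ?thesis unfolding w[OF that(2)] using vV that by simp
  qed
  thus ?thesis using v(1) v0 by blast
qed

text \<open>For a matrix with entries \<open>v_i w_j\<close> the square is the trace times the
  matrix. Idempotence, read off at a nonzero entry, makes the trace 1.\<close>

lemma rank_one_projection_trace: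
  fixes A :: "complex mat"
  assumes A: "A \<in> carrier_mat n n" and r: "vec_space.rank n A = 1" and AA: "A * A = A"
  shows "(\<Sum>i<n. A $$ (i, i)) = 1"
proof -
  obtain v w where v: "v \<in> set (cols A)" "v \<noteq> 0\<^sub>v n"
    and A_idx: "\<And>i j. i < n \<Longrightarrow> j < n \<Longrightarrow> A $$ (i, j) = vec_index v i * w j"
    using rank_one_outer[OF A r] by blast
  have vV: "v \<in> carrier_vec n" using v(1) cols_dim[of A] A by auto
  then obtain i where i: "i < n" "vec_index v i \<noteq> 0"
    using v(2) by (metis carrier_vecD eq_vecI index_zero_vec)
  obtain j where j: "j < n" "v = col A j" using v(1) A by (metis carrier_matD(2) cols_length cols_nth in_set_conv_nth)
  have nz: "A $$ (i, j) \<noteq> 0" using i j A by simp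
  have "A $$ (i, j) = (A * A) $$ (i, j)" unfolding AA ..
  also have "\<dots> = (\<Sum>l<n. A $$ (i, l) * A $$ (l, j))"
    using A i j by (auto simp: scalar_prod_def lessThan_atLeast0)
  also have "\<dots> = (\<Sum>l<n. A $$ (l, l)) * A $$ (i, j)"
    unfolding sum_distrib_right using i j by (intro sum.cong refl) (simp add: A_idx)
  finally show ?thesis using nz by simp
qed

section \<open>Paths generated by product Hamiltonians\<close>

text \<open>\<open>R\<close> is the state as a matrix from the second subsystem to the first, and
  the reduced state is \<open>R R*\<close>. The left-hand side is the derivative of the sum of
  \<open>c p\<close> times the squared norm of \<open>\<phi> p\<close> under the generator
  \<open>A \<otimes> B\<close>, with \<open>u\<close> held fixed. In the eigenbasis it becomes the
  expression of \<open>eigenbasis_rate_bound\<close>.\<close>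

lemma product_rate_bound:
  fixes R :: "nat \<Rightarrow> 'z \<Rightarrow> complex" and A :: "nat \<Rightarrow> nat \<Rightarrow> complex" and c :: "nat \<Rightarrow> real"
  assumes finZ: "finite Z"
    and diag: "diagonalises d (\<lambda>i j. \<Sum>z\<in>Z. R i z * cnj (R j z)) u e"
    and tr: "(\<Sum>p<d. e p) = 1"
    and hA: "hermitian_on {..<d} A" and iA: "isometric_on {..<d} A"
    and hB: "hermitian_on Z B" and iB: "isometric_on Z B"
    and c: "\<And>p q. p < d \<Longrightarrow> q < d \<Longrightarrow> sqrt (e p * e q) * \<bar>c p - c q\<bar> \<le> \<bar>e p - e q\<bar>"
  shows "\<bar>\<Sum>p<d. c p * (2 * Re (inner_on Z (\<lambda>z. \<Sum>i<d. cnj (u p i) * R i z)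
      (\<lambda>z. \<Sum>i<d. cnj (u p i) * (- \<i> * (\<Sum>j<d. \<Sum>w\<in>Z. A i j * B z w * R j w)))))\<bar> \<le> 2"
proof -
  have onb: "orthonormal_basis d u"
    and r: "\<And>i j. i < d \<Longrightarrow> j < d \<Longrightarrow>
      (\<Sum>z\<in>Z. R i z * cnj (R j z)) = (\<Sum>p<d. u p i * complex_of_real (e p) * cnj (u p j))"
    using diag unfolding diagonalises_def by auto
  define \<phi> where "\<phi> p z = (\<Sum>i<d. cnj (u p i) * R i z)" for p z
  define A' where "A' p q = inner_on {..<d} (u p) (apply_on {..<d} A (u q))" for p q
  have uu: "inner_on {..<d} (u p) (u q) = of_bool (p = q)" if "p < d" "q < d" for p q
    using onb that unfolding orthonormal_basis_def by blast
  have orth: "inner_on Z (\<phi> p) (\<phi> q) = complex_of_real (of_bool (p = q) * e p)" if pq: "p < d" "q < d" for p q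
  proof -
    have "inner_on Z (\<phi> p) (\<phi> q) = (\<Sum>z\<in>Z. \<Sum>i<d. \<Sum>j<d. (u p i * cnj (u q j)) * (R j z * cnj (R i z)))"
      unfolding inner_on_def \<phi>_def cnj_sum sum_product by (simp add: mult_ac)
    also have "\<dots> = (\<Sum>i<d. \<Sum>j<d. \<Sum>z\<in>Z. (u p i * cnj (u q j)) * (R j z * cnj (R i z)))"
      by (subst sum.swap, rule sum.cong[OF refl], rule sum.swap)
    also have "\<dots> = (\<Sum>i<d. \<Sum>j<d. \<Sum>s<d. (u p i * cnj (u q j)) * (u s j * complex_of_real (e s) * cnj (u s i)))"
      unfolding sum_distrib_left[symmetric] by (intro sum.cong refl) (simp add: r)
    also have "\<dots> = (\<Sum>i<d. \<Sum>s<d. \<Sum>j<d. complex_of_real (e s) * ((cnj (u s i) * u p i) * (cnj (u q j) * u s j)))"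
      by (rule sum.cong[OF refl], subst sum.swap) (simp add: mult_ac)
    also have "\<dots> = (\<Sum>s<d. \<Sum>i<d. \<Sum>j<d. complex_of_real (e s) * ((cnj (u s i) * u p i) * (cnj (u q j) * u s j)))"
      by (rule sum.swap)
    also have "\<dots> = (\<Sum>s<d. complex_of_real (e s) * (inner_on {..<d} (u s) (u p) * inner_on {..<d} (u q) (u s)))"
      unfolding inner_on_def sum_product by (simp only: sum_distrib_left)
    also have "\<dots> = (\<Sum>s<d. (complex_of_real (e s) * of_bool (q = s)) * of_bool (s = p))"
      using pq by (intro sum.cong refl) (simp add: uu)
    also have "\<dots> = complex_of_real (e p) * of_bool (q = p)"
      using pq by (simp add: sum_mult_of_bool_eq)
    finally show ?thesis by (cases "p = q") auto
  qed
  \<comment> \<open>Completeness of the eigenbasis recovers \<open>R\<close> from the Schmidt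
    vectors.\<close>
  have R_eq: "R j w = (\<Sum>q<d. u q j * \<phi> q w)" if j: "j < d" for j w
  proof -
    have "(\<Sum>q<d. u q j * \<phi> q w) = (\<Sum>i<d. R i w * (\<Sum>q<d. u q j * cnj (u q i)))"
      unfolding \<phi>_def sum_distrib_left by (subst sum.swap) (simp add: mult_ac)
    also have "\<dots> = (\<Sum>i<d. R i w * of_bool (j = i))"
      using onb j unfolding orthonormal_basis_def by (intro sum.cong refl) auto
    finally show ?thesis using j by (simp add: sum_mult_of_bool_eq')
  qed
  \<comment> \<open>Expanding \<open>R\<close> in the Schmidt vectors separates the factors:
    \<open>A\<close> acts on the eigenvectors, giving \<open>A'\<close>, and \<open>B\<close> on the
    Schmidt vectors.\<close>
  have \<phi>': "(\<Sum>i<d. cnj (u p i) * (- \<i> * (\<Sum>j<d. \<Sum>w\<in>Z. A i j * B z w * R j w)))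
      = (\<Sum>q<d. (- \<i> * A' p q) * apply_on Z B (\<phi> q) z)" for p z
  proof -
    have "(\<Sum>j<d. \<Sum>w\<in>Z. A i j * B z w * R j w)
        = (\<Sum>q<d. apply_on {..<d} A (u q) i * apply_on Z B (\<phi> q) z)" for i
    proof -
      have "(\<Sum>j<d. \<Sum>w\<in>Z. A i j * B z w * R j w)
          = (\<Sum>j<d. \<Sum>w\<in>Z. \<Sum>q<d. (A i j * u q j) * (B z w * \<phi> q w))"
        by (intro sum.cong refl) (simp add: R_eq sum_distrib_left mult_ac)
      also have "\<dots> = (\<Sum>j<d. \<Sum>q<d. \<Sum>w\<in>Z. (A i j * u q j) * (B z w * \<phi> q w))"
        by (rule sum.cong[OF refl], rule sum.swap)
      also have "\<dots> = (\<Sum>q<d. \<Sum>j<d. \<Sum>w\<in>Z. (A i j * u q j) * (B z w * \<phi> q w))"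
        by (rule sum.swap)
      finally show ?thesis unfolding apply_on_def sum_product .
    qed
    hence "(\<Sum>i<d. cnj (u p i) * (- \<i> * (\<Sum>j<d. \<Sum>w\<in>Z. A i j * B z w * R j w)))
        = (\<Sum>i<d. \<Sum>q<d. (- \<i> * apply_on Z B (\<phi> q) z) * (cnj (u p i) * apply_on {..<d} A (u q) i))"
      by (simp add: sum_distrib_left mult_ac)
    also have "\<dots> = (\<Sum>q<d. (- \<i> * apply_on Z B (\<phi> q) z) * A' p q)"
      unfolding A'_def inner_on_def sum_distrib_left by (rule sum.swap)
    finally show ?thesis by (simp add: mult_ac)
  qed
  have A'_alt: "A' p q = inner_on {..<d} (apply_on {..<d} A (u p)) (u q)" for p q
    unfolding A'_def by (rule inner_on_apply_on[OF hA])
  have "hermitian_on {..<d} A'"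
    unfolding hermitian_on_def by (metis A'_def A'_alt inner_on_cnj)
  moreover have "(\<Sum>q<d. (cmod (A' p q))\<^sup>2) \<le> 1" if p: "p < d" for p
  proof -
    have "(\<Sum>q<d. (cmod (A' p q))\<^sup>2) = (\<Sum>q<d. (cmod (inner_on {..<d} (u q) (apply_on {..<d} A (u p))))\<^sup>2)"
      unfolding A'_alt by (metis (no_types) complex_mod_cnj inner_on_cnj)
    also have "\<dots> = (\<Sum>i<d. (cmod (apply_on {..<d} A (u p) i))\<^sup>2)" by (rule parseval[OF onb])
    also have "\<dots> = 1"
    proof -
      have "complex_of_real (\<Sum>i<d. (cmod (apply_on {..<d} A (u p) i))\<^sup>2) = 1"
        unfolding inner_on_self[symmetric] using uu[OF p p] by (simp add: inner_on_isometric[OF _ iA])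
      thus ?thesis by (metis of_real_eq_1_iff)
    qed
    finally show ?thesis by simp
  qed
  ultimately have "\<bar>\<Sum>p<d. c p * (2 * Im (\<Sum>q<d. A' p q * inner_on Z (\<phi> p) (apply_on Z B (\<phi> q))))\<bar> \<le> 2"
    using finZ hB iB tr c by (intro eigenbasis_rate_bound[where lam = e] orth) auto
  \<comment> \<open>The factor \<open>-i\<close> of the evolution equation turns real parts into
    imaginary parts: \<open>Re (-i z) = Im z\<close>.\<close>
  moreover have "Re (inner_on Z (\<phi> p) (\<lambda>z. \<Sum>q<d. (- \<i> * A' p q) * apply_on Z B (\<phi> q) z))
      = Im (\<Sum>q<d. A' p q * inner_on Z (\<phi> p) (apply_on Z B (\<phi> q)))" for p
    unfolding inner_on_sum_right Re_sum Im_sum by (intro sum.cong refl) simp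
  ultimately show ?thesis unfolding \<phi>' \<phi>_def[symmetric] by simp
qed

lemma has_real_derivative_cmod_square:
  assumes "(f has_vector_derivative f') (at t within S)"
  shows "((\<lambda>s. (cmod (f s))\<^sup>2) has_real_derivative 2 * Re (cnj (f t) * f')) (at t within S)"
proof -
  have re: "((\<lambda>s. Re (f s)) has_real_derivative Re f') (at t within S)"
    and im: "((\<lambda>s. Im (f s)) has_real_derivative Im f') (at t within S)"
    using assms unfolding has_real_derivative_iff_has_vector_derivative
    by (auto intro: bounded_linear.has_vector_derivative[OF bounded_linear_Re]
        bounded_linear.has_vector_derivative[OF bounded_linear_Im])
  show ?thesis unfolding cmod_power2
    by (rule DERIV_cong[OF DERIV_add[OF DERIV_power[OF re, of 2] DERIV_power[OF im, of 2]]]) simp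
qed

text \<open>Shows that the eigenvalues of a Gram matrix are nonnegative and reduces derivatives of
  the form to derivatives of squared moduli.\<close>

lemma quad_form_gram:
  "quad_form d (\<lambda>i j. \<Sum>z\<in>Z. R i z * cnj (R j z)) v = (\<Sum>z\<in>Z. (cmod (\<Sum>i<d. cnj (v i) * R i z))\<^sup>2)"
proof -
  have "(\<Sum>i<d. \<Sum>j<d. cnj (v i) * (\<Sum>z\<in>Z. R i z * cnj (R j z)) * v j)
      = (\<Sum>i<d. \<Sum>j<d. \<Sum>z\<in>Z. (cnj (v i) * R i z) * cnj (cnj (v j) * R j z))"
    by (simp add: sum_distrib_left sum_distrib_right mult_ac)
  also have "\<dots> = (\<Sum>i<d. \<Sum>z\<in>Z. \<Sum>j<d. (cnj (v i) * R i z) * cnj (cnj (v j) * R j z))"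
    by (rule sum.cong[OF refl], rule sum.swap)
  also have "\<dots> = (\<Sum>z\<in>Z. \<Sum>i<d. \<Sum>j<d. (cnj (v i) * R i z) * cnj (cnj (v j) * R j z))"
    by (rule sum.swap)
  also have "\<dots> = complex_of_real (\<Sum>z\<in>Z. (cmod (\<Sum>i<d. cnj (v i) * R i z))\<^sup>2)"
    unfolding of_real_sum complex_norm_square cnj_sum sum_product ..
  finally show ?thesis unfolding quad_form_def by simp
qed

text \<open>For a frozen eigenbasis the rate is linear in the generator. The triangle inequality
  over its terms and \<open>product_rate_bound\<close> for each of them give twice the sum of
  \<open>\<bar>h \<sigma> t\<bar>\<close>, whose primitive is the \<open>G\<close> of
  \<open>entropy_increment\<close>.\<close>

lemma product_path_entropy_bound:
  fixes R :: "real \<Rightarrow> nat \<Rightarrow> 'z \<Rightarrow> complex" and h :: "'s \<Rightarrow> real \<Rightarrow> real"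
  assumes finZ: "finite Z" and finS: "finite S"
    and h: "\<And>\<sigma>. \<sigma> \<in> S \<Longrightarrow> continuous_on {0..1} (h \<sigma>)"
    and hA: "\<And>\<sigma>. \<sigma> \<in> S \<Longrightarrow> hermitian_on {..<d} (A \<sigma>)"
    and iA: "\<And>\<sigma>. \<sigma> \<in> S \<Longrightarrow> isometric_on {..<d} (A \<sigma>)"
    and hB: "\<And>\<sigma>. \<sigma> \<in> S \<Longrightarrow> hermitian_on Z (B \<sigma>)"
    and iB: "\<And>\<sigma>. \<sigma> \<in> S \<Longrightarrow> isometric_on Z (B \<sigma>)"
    and R: "\<And>t i z. t \<in> {0..1} \<Longrightarrow> i < d \<Longrightarrow> z \<in> Z \<Longrightarrow> ((\<lambda>s. R s i z) has_vector_derivative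
      (\<Sum>\<sigma>\<in>S. complex_of_real (h \<sigma> t) * (- \<i> * (\<Sum>j<d. \<Sum>w\<in>Z. A \<sigma> i j * B \<sigma> z w * R t j w))))
        (at t within {0..1})"
    and tr: "\<And>t. t \<in> {0..1} \<Longrightarrow> (\<Sum>i<d. \<Sum>z\<in>Z. (cmod (R t i z))\<^sup>2) = 1"
  shows "\<exists>u e. (\<forall>t\<in>{0..1}. diagonalises d (\<lambda>i j. \<Sum>z\<in>Z. R t i z * cnj (R t j z)) (u t) (e t)) \<and>
    \<bar>(\<Sum>p<d. e 1 p * ln (e 1 p)) - (\<Sum>p<d. e 0 p * ln (e 0 p))\<bar>
      \<le> 2 * integral {0..1} (\<lambda>t. \<Sum>\<sigma>\<in>S. \<bar>h \<sigma> t\<bar>)"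
proof -
  define r where "r t i j = (\<Sum>z\<in>Z. R t i z * cnj (R t j z))" for t i j
  have "\<exists>u e. diagonalises d (r t) u e" for t
    by (rule hermitian_diagonalises) (simp add: r_def mult.commute)
  then obtain u e where diag: "\<And>t. diagonalises d (r t) (u t) (e t)" by metis
  have e_nonneg: "e t p \<ge> 0" if "p < d" for t p
    using quad_form_eigenvector[OF diag that, of t] quad_form_gram[of d "R t" Z "u t p"]
    unfolding r_def by (metis (no_types, lifting) sum_nonneg zero_le_power2)
  have e_sum: "(\<Sum>p<d. e t p) = 1" if t: "t \<in> {0..1}" for t
  proof -
    have onb: "orthonormal_basis d (u t)" using diag unfolding diagonalises_def by simp
    have "complex_of_real (\<Sum>i<d. \<Sum>z\<in>Z. (cmod (R t i z))\<^sup>2) = (\<Sum>i<d. r t i i)"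
      unfolding r_def of_real_sum complex_norm_square ..
    also have "\<dots> = (\<Sum>i<d. \<Sum>p<d. u t p i * complex_of_real (e t p) * cnj (u t p i))"
      using diag unfolding diagonalises_def by (intro sum.cong refl) auto
    also have "\<dots> = (\<Sum>p<d. complex_of_real (e t p) * inner_on {..<d} (u t p) (u t p))"
      unfolding inner_on_def sum_distrib_left by (subst sum.swap) (simp add: mult_ac)
    also have "\<dots> = complex_of_real (\<Sum>p<d. e t p)"
      using onb unfolding orthonormal_basis_def of_real_sum by (intro sum.cong refl) auto
    finally show ?thesis using tr[OF t] unfolding of_real_eq_iff by simp
  qed
  have e01: "e t p \<in> {0..1}" if "t \<in> {0..1}" "p < d" for t p
    using member_le_sum[of p "{..<d}" "e t"] e_nonneg e_sum[OF that(1)] that(2) by auto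
  define g where "g t = 2 * (\<Sum>\<sigma>\<in>S. \<bar>h \<sigma> t\<bar>)" for t
  have cg: "continuous_on {0..1} g" unfolding g_def using h by (intro continuous_intros) auto
  have contR: "continuous_on {0..1} (\<lambda>s. R s i z)" if "i < d" "z \<in> Z" for i z
    using R[OF _ that] by (meson continuous_on_eq_continuous_within has_vector_derivative_continuous)
  have "\<bar>(\<Sum>p<d. e 1 p * ln (e 1 p)) - (\<Sum>p<d. e 0 p * ln (e 0 p))\<bar>
      \<le> integral {0..1} g - integral {0..0} g"
  proof (rule entropy_increment[where r = r and u = u and G = "\<lambda>t. integral {0..t} g"])
    show "continuous_on {0..1} (\<lambda>s. r s i j)" if "i < d" "j < d" for i j
      unfolding r_def using that by (intro continuous_intros contR) auto
    show "((\<lambda>t. integral {0..t} g) has_real_derivative g t) (at t within {0..1})" if "t \<in> {0..1}" for t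
      by (rule integral_has_real_derivative[OF cg that])
    fix t and c :: "nat \<Rightarrow> real"
    assume t: "t \<in> {0..1}"
      and c: "\<And>p q. p < d \<Longrightarrow> q < d \<Longrightarrow> sqrt (e t p * e t q) * \<bar>c p - c q\<bar> \<le> \<bar>e t p - e t q\<bar>"
    \<comment> \<open>\<open>R' \<sigma>\<close> is the velocity of \<open>R\<close> due to the term
      \<open>\<sigma>\<close> with unit coefficient; \<open>\<phi>\<close> and
      \<open>\<psi> \<sigma>\<close> are \<open>R\<close> and this velocity in the eigenbasis at
      time \<open>t\<close>, which stays fixed while \<open>s\<close> varies.\<close>
    define R' where "R' \<sigma> i z = - \<i> * (\<Sum>j<d. \<Sum>w\<in>Z. A \<sigma> i j * B \<sigma> z w * R t j w)" for \<sigma> i z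
    define \<phi> where "\<phi> s p z = (\<Sum>i<d. cnj (u t p i) * R s i z)" for s p z
    define \<psi> where "\<psi> \<sigma> p z = (\<Sum>i<d. cnj (u t p i) * R' \<sigma> i z)" for \<sigma> p z
    define D where "D = (\<Sum>p<d. c p * (\<Sum>z\<in>Z. 2 * Re (cnj (\<phi> t p z) * (\<Sum>\<sigma>\<in>S. complex_of_real (h \<sigma> t) * \<psi> \<sigma> p z))))"
    have \<phi>_deriv: "((\<lambda>s. \<phi> s p z) has_vector_derivative (\<Sum>\<sigma>\<in>S. complex_of_real (h \<sigma> t) * \<psi> \<sigma> p z)) (at t within {0..1})"
      if z: "z \<in> Z" for p z
    proof -
      have "((\<lambda>s. \<phi> s p z) has_vector_derivative
          (\<Sum>i<d. cnj (u t p i) * (\<Sum>\<sigma>\<in>S. complex_of_real (h \<sigma> t) * R' \<sigma> i z))) (at t within {0..1})"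
        unfolding \<phi>_def R'_def
        by (intro has_vector_derivative_sum has_vector_derivative_mult_right R t z) simp
      also have "(\<Sum>i<d. cnj (u t p i) * (\<Sum>\<sigma>\<in>S. complex_of_real (h \<sigma> t) * R' \<sigma> i z))
          = (\<Sum>\<sigma>\<in>S. complex_of_real (h \<sigma> t) * \<psi> \<sigma> p z)"
        unfolding \<psi>_def sum_distrib_left by (subst sum.swap) (simp add: mult_ac)
      finally show ?thesis .
    qed
    have D_deriv: "((\<lambda>s. \<Sum>p<d. c p * quad_form d (r s) (u t p)) has_real_derivative D) (at t within {0..1})"
      unfolding r_def quad_form_gram \<phi>_def[symmetric] D_def
      by (intro DERIV_sum DERIV_cmult has_real_derivative_cmod_square \<phi>_deriv)
    have "D = (\<Sum>\<sigma>\<in>S. h \<sigma> t * (\<Sum>p<d. c p * (2 * Re (inner_on Z (\<phi> t p) (\<psi> \<sigma> p)))))"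
    proof -
      have "(\<Sum>z\<in>Z. 2 * Re (cnj (\<phi> t p z) * (\<Sum>\<sigma>\<in>S. complex_of_real (h \<sigma> t) * \<psi> \<sigma> p z)))
          = (\<Sum>\<sigma>\<in>S. h \<sigma> t * (2 * Re (inner_on Z (\<phi> t p) (\<psi> \<sigma> p))))" for p
      proof -
        have "(\<Sum>z\<in>Z. 2 * Re (cnj (\<phi> t p z) * (\<Sum>\<sigma>\<in>S. complex_of_real (h \<sigma> t) * \<psi> \<sigma> p z)))
            = 2 * Re (inner_on Z (\<phi> t p) (\<lambda>z. \<Sum>\<sigma>\<in>S. complex_of_real (h \<sigma> t) * \<psi> \<sigma> p z))"
          unfolding inner_on_def Re_sum sum_distrib_left ..
        also have "\<dots> = (\<Sum>\<sigma>\<in>S. h \<sigma> t * (2 * Re (inner_on Z (\<phi> t p) (\<psi> \<sigma> p))))"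
          unfolding inner_on_sum_right Re_sum sum_distrib_left by (intro sum.cong refl) simp
        finally show ?thesis .
      qed
      hence "D = (\<Sum>p<d. \<Sum>\<sigma>\<in>S. h \<sigma> t * (c p * (2 * Re (inner_on Z (\<phi> t p) (\<psi> \<sigma> p)))))"
        unfolding D_def by (simp add: sum_distrib_left mult_ac)
      thus ?thesis unfolding sum_distrib_left by (subst (asm) sum.swap) simp
    qed
    hence "\<bar>D\<bar> \<le> (\<Sum>\<sigma>\<in>S. \<bar>h \<sigma> t\<bar> * \<bar>\<Sum>p<d. c p * (2 * Re (inner_on Z (\<phi> t p) (\<psi> \<sigma> p)))\<bar>)"
      by (simp add: sum_abs abs_mult[symmetric])
    also have "\<dots> \<le> (\<Sum>\<sigma>\<in>S. \<bar>h \<sigma> t\<bar> * 2)"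
    proof (intro sum_mono mult_left_mono)
      fix \<sigma> assume \<sigma>: "\<sigma> \<in> S"
      show "\<bar>\<Sum>p<d. c p * (2 * Re (inner_on Z (\<phi> t p) (\<psi> \<sigma> p)))\<bar> \<le> 2"
        unfolding \<phi>_def \<psi>_def R'_def
        using diag[of t] unfolding r_def
        by (intro product_rate_bound[where e = "e t"] finZ e_sum[OF t] hA[OF \<sigma>] iA[OF \<sigma>] hB[OF \<sigma>] iB[OF \<sigma>] c)
    qed simp
    also have "\<dots> = g t" unfolding g_def by (simp add: sum_distrib_left mult.commute)
    finally show "\<exists>D. ((\<lambda>s. \<Sum>p<d. c p * quad_form d (r s) (u t p)) has_real_derivative D) (at t within {0..1})
        \<and> \<bar>D\<bar> \<le> g t"
      using D_deriv by blast
  qed (use diag e01 in auto)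
  moreover have "integral {0..1} g = 2 * integral {0..1} (\<lambda>t. \<Sum>\<sigma>\<in>S. \<bar>h \<sigma> t\<bar>)"
    unfolding g_def by (rule integral_mult_right)
  ultimately show ?thesis using diag unfolding r_def by (intro exI[of _ u] exI[of _ e]) simp
qed

section \<open>Circuit complexity\<close>

lemma finite_pauli_strings: "finite (pauli_strings n)"
proof -
  have "(UNIV :: pauli set) \<subseteq> {PI, PX, PY, PZ}" using pauli.exhaust by blast
  hence "finite (UNIV :: pauli set)" by (rule finite_subset) simp
  thus ?thesis unfolding pauli_strings_def using finite_lists_length_eq[of "UNIV :: pauli set" n] by simp
qed

lemma smooth_on_unit_interval_continuous:
  assumes "smooth_on_unit_interval f"
  shows "continuous_on {0..1} f"
proof -
  obtain D where D: "\<And>s. s \<in> {0..1} \<Longrightarrow> D 0 s = f s"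
    "\<And>s. s \<in> {0..1} \<Longrightarrow> (D 0 has_real_derivative D (Suc 0) s) (at s within {0..1})"
    using assms unfolding smooth_on_unit_interval_def by blast
  have "continuous_on {0..1} (D 0)"
    using D(2) by (meson DERIV_continuous continuous_on_eq_continuous_within)
  thus ?thesis by (rule continuous_on_eq) (rule D(1))
qed

lemma diagonalises_cong:
  assumes "\<And>i j. i < d \<Longrightarrow> j < d \<Longrightarrow> r i j = r' i j"
  shows "diagonalises d r u e \<longleftrightarrow> diagonalises d r' u e"
  unfolding diagonalises_def using assms by auto

text \<open>If \<open>\<rho> = M M*\<close>, then tracing out the last qubits sums over
  \<open>x\<close> in addition to the column \<open>m\<close>. The reduced state is thus again a
  Gram matrix, now over the pairs \<open>(x, m)\<close>.\<close>

lemma entropy_of_gram: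
  assumes n: "k \<le> n"
    and \<rho>: "\<And>p q. p < 2 ^ n \<Longrightarrow> q < 2 ^ n \<Longrightarrow> \<rho> $$ (p, q) = (\<Sum>m<N. M p m * cnj (M q m))"
    and diag: "diagonalises (2 ^ k)
      (\<lambda>i j. \<Sum>(x, m)\<in>{..<2 ^ (n - k)} \<times> {..<N}. M (i * 2 ^ (n - k) + x) m * cnj (M (j * 2 ^ (n - k) + x) m)) u e"
  shows "entanglement_entropy n k \<rho> = - (\<Sum>p<2 ^ k. e p * ln (e p))"
proof -
  have ab: "2 ^ k * 2 ^ (n - k) = (2 ^ n :: nat)" using n by (simp flip: power_add)
  have "reduced_state n k \<rho> $$ (i, j) = (\<Sum>(x, m)\<in>{..<2 ^ (n - k)} \<times> {..<N}.
      M (i * 2 ^ (n - k) + x) m * cnj (M (j * 2 ^ (n - k) + x) m))" if "i < 2 ^ k" "j < 2 ^ k" for i j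
  proof -
    have "reduced_state n k \<rho> $$ (i, j)
        = (\<Sum>x<2 ^ (n - k). \<rho> $$ (i * 2 ^ (n - k) + x, j * 2 ^ (n - k) + x))"
      unfolding reduced_state_def using that by simp
    also have "\<dots> = (\<Sum>x<2 ^ (n - k). \<Sum>m<N. M (i * 2 ^ (n - k) + x) m * cnj (M (j * 2 ^ (n - k) + x) m))"
      using that by (intro sum.cong refl \<rho>) (auto simp flip: ab intro: mult_add_less_mult)
    finally show ?thesis by (simp add: sum.cartesian_product)
  qed
  hence "diagonalises (2 ^ k) (\<lambda>i j. reduced_state n k \<rho> $$ (i, j)) u e"
    using diag by (subst diagonalises_cong) auto
  from matrix_trace_mult_herm_fun[OF _ this, of ln] show ?thesis
    unfolding entanglement_entropy_def by (simp add: reduced_state_def)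
qed

lemma entropy_change_le_path_cost:
  assumes k: "k \<le> n" and \<rho>\<^sub>0: "pure_state n \<rho>\<^sub>0"
    and smooth: "\<And>\<sigma>. \<sigma> \<in> pauli_strings n \<Longrightarrow> smooth_on_unit_interval (h \<sigma>)"
    and U: "propagator n h U" and \<rho>\<^sub>1: "U 1 * \<rho>\<^sub>0 * mat_adjoint (U 1) = \<rho>\<^sub>1"
  shows "\<bar>entanglement_entropy n k \<rho>\<^sub>1 - entanglement_entropy n k \<rho>\<^sub>0\<bar> \<le> 2 * path_cost n h"
proof -
  define a b N where "a = (2 ^ k :: nat)" and "b = (2 ^ (n - k) :: nat)" and "N = (2 ^ n :: nat)"
  have ab: "a * b = N" unfolding a_def b_def N_def using k by (simp flip: power_add)
  have \<rho>\<^sub>0c: "\<rho>\<^sub>0 \<in> carrier_mat N N" and \<rho>\<^sub>0h: "mat_adjoint \<rho>\<^sub>0 = \<rho>\<^sub>0" and \<rho>\<^sub>0p: "\<rho>\<^sub>0 * \<rho>\<^sub>0 = \<rho>\<^sub>0"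
    and \<rho>\<^sub>0r: "vec_space.rank N \<rho>\<^sub>0 = 1"
    using \<rho>\<^sub>0 unfolding pure_state_def N_def by auto
  have \<rho>\<^sub>0_idx: "\<rho>\<^sub>0 $$ (p, q) = cnj (\<rho>\<^sub>0 $$ (q, p))" if "p < N" "q < N" for p q
    using adjoint_index[of p \<rho>\<^sub>0 q] that \<rho>\<^sub>0c unfolding \<rho>\<^sub>0h by auto
  have Uc: "U s \<in> carrier_mat N N" if "s \<in> {0..1}" for s
    using U that unfolding propagator_def N_def by blast
  have U0: "U 0 = 1\<^sub>m N" using U unfolding propagator_def N_def by blast
  define H where "H t p q = generator n h t $$ (p, q)" for t p q
  have H_eq: "H t p q = (\<Sum>\<sigma>\<in>pauli_strings n. complex_of_real (h \<sigma> t) * pauli_operator \<sigma> $$ (p, q))"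
    if "p < N" "q < N" for t p q
    using that unfolding H_def generator_def N_def by simp
  \<comment> \<open>\<open>M s\<close> is the product of \<open>U s\<close> with the initial state;
    it obeys the same linear equation as \<open>U\<close>.\<close>
  define M where "M s p m = (\<Sum>l<N. U s $$ (p, l) * \<rho>\<^sub>0 $$ (l, m))" for s p m
  have M_deriv: "((\<lambda>s. M s p m) has_vector_derivative (- \<i> * (\<Sum>q<N. H t p q * M t q m))) (at t within {0..1})"
    if t: "t \<in> {0..1}" and p: "p < N" for t p m
  proof -
    have Gc: "generator n h t \<in> carrier_mat N N" unfolding generator_def N_def by simp
    have dU: "((\<lambda>s. U s $$ (p, l)) has_vector_derivative (- \<i> * (\<Sum>q<N. H t p q * U t $$ (q, l)))) (at t within {0..1})"
      if l: "l < N" for l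
    proof -
      have "((- \<i>) \<cdot>\<^sub>m (generator n h t * U t)) $$ (p, l) = - \<i> * (generator n h t * U t) $$ (p, l)"
        using Gc Uc[OF t] p l by simp
      also have "(generator n h t * U t) $$ (p, l) = (\<Sum>q<N. H t p q * U t $$ (q, l))"
        unfolding H_def by (rule mat_mult_index_sum[OF Gc Uc[OF t] p l])
      finally show ?thesis using U t p l unfolding propagator_def N_def[symmetric] by metis
    qed
    have "((\<lambda>s. M s p m) has_vector_derivative
        (\<Sum>l<N. (- \<i> * (\<Sum>q<N. H t p q * U t $$ (q, l))) * \<rho>\<^sub>0 $$ (l, m))) (at t within {0..1})"
      unfolding M_def by (intro has_vector_derivative_sum has_vector_derivative_mult_left dU) simp
    also have "(\<Sum>l<N. (- \<i> * (\<Sum>q<N. H t p q * U t $$ (q, l))) * \<rho>\<^sub>0 $$ (l, m))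
        = (\<Sum>l<N. \<Sum>q<N. - \<i> * (H t p q * (U t $$ (q, l) * \<rho>\<^sub>0 $$ (l, m))))"
      by (simp add: sum_distrib_left sum_distrib_right mult_ac)
    also have "\<dots> = (\<Sum>q<N. \<Sum>l<N. - \<i> * (H t p q * (U t $$ (q, l) * \<rho>\<^sub>0 $$ (l, m))))"
      by (rule sum.swap)
    also have "\<dots> = - \<i> * (\<Sum>q<N. H t p q * M t q m)"
      unfolding M_def sum_distrib_left ..
    finally show ?thesis .
  qed

  \<comment> \<open>Conservation of the norm\<close>
  have H_herm: "hermitian_on {..<N} (H t)" for t
    unfolding hermitian_on_def
  proof (intro ballI)
    fix p q assume "p \<in> {..<N}" "q \<in> {..<N}"
    hence pq: "p < N" "q < N" by auto
    show "H t p q = cnj (H t q p)"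
      unfolding H_eq[OF pq] H_eq[OF pq(2,1)] cnj_sum
    proof (intro sum.cong refl)
      fix \<sigma> assume "\<sigma> \<in> pauli_strings n"
      hence "N = 2 ^ length \<sigma>" unfolding pauli_strings_def N_def by simp
      thus "complex_of_real (h \<sigma> t) * pauli_operator \<sigma> $$ (p, q)
          = cnj (complex_of_real (h \<sigma> t) * pauli_operator \<sigma> $$ (q, p))"
        using pauli_operator_hermitian[of p \<sigma> q] pq by simp
    qed
  qed
  have M0: "M 0 p m = \<rho>\<^sub>0 $$ (p, m)" if "p < N" "m < N" for p m
    using mat_mult_index_sum[of "U 0" N N \<rho>\<^sub>0 N p m] that \<rho>\<^sub>0c unfolding M_def U0 by simp
  \<comment> \<open>The derivative of the sum of squares is twice the imaginary part of the
    expectation values of \<open>H t\<close> in the columns of \<open>M t\<close>, which are real.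
    At time 0 the sum is the trace of
    \<open>\<rho>\<^sub>0 * \<rho>\<^sub>0 = \<rho>\<^sub>0\<close>, hence 1.\<close>
  have norm_M: "(\<Sum>p<N. \<Sum>m<N. (cmod (M t p m))\<^sup>2) = 1" if t: "t \<in> {0..1}" for t
  proof -
    define T where "T t = (\<Sum>p<N. \<Sum>m<N. (cmod (M t p m))\<^sup>2)" for t
    have "(T has_real_derivative 0) (at t within {0..1})" if t: "t \<in> {0..1}" for t
    proof -
      have "(T has_real_derivative (\<Sum>p<N. \<Sum>m<N. 2 * Re (cnj (M t p m) * (- \<i> * (\<Sum>q<N. H t p q * M t q m)))))
          (at t within {0..1})"
        unfolding T_def by (intro DERIV_sum has_real_derivative_cmod_square M_deriv t) simp
      also have "(\<Sum>p<N. \<Sum>m<N. 2 * Re (cnj (M t p m) * (- \<i> * (\<Sum>q<N. H t p q * M t q m))))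
          = (\<Sum>m<N. 2 * Im (inner_on {..<N} (\<lambda>p. M t p m) (apply_on {..<N} (H t) (\<lambda>p. M t p m))))"
        unfolding inner_on_def apply_on_def Im_sum sum_distrib_left[of 2]
        by (subst sum.swap) (intro sum.cong refl, simp add: algebra_simps)
      also have "\<dots> = 0"
      proof (rule sum.neutral, rule ballI)
        fix m
        let ?f = "\<lambda>p. M t p m"
        have "cnj (inner_on {..<N} ?f (apply_on {..<N} (H t) ?f)) = inner_on {..<N} ?f (apply_on {..<N} (H t) ?f)"
          unfolding inner_on_cnj inner_on_apply_on[OF H_herm] ..
        thus "2 * Im (inner_on {..<N} ?f (apply_on {..<N} (H t) ?f)) = 0"
          by (metis complex_cnj_cancel_iff equal_neg_zero cnj.simps(2) mult_zero_right)
      qed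
      finally show ?thesis .
    qed
    hence "\<exists>c. \<forall>t\<in>{0..1}. T t = c" by (intro has_field_derivative_zero_constant) auto
    hence "T t = T 0" using t by auto
    also have "complex_of_real (T 0) = (\<Sum>p<N. (\<rho>\<^sub>0 * \<rho>\<^sub>0) $$ (p, p))"
      unfolding T_def of_real_sum complex_norm_square
    proof (rule sum.cong[OF refl])
      fix p assume "p \<in> {..<N}"
      hence p: "p < N" by simp
      show "(\<Sum>m<N. M 0 p m * cnj (M 0 p m)) = (\<rho>\<^sub>0 * \<rho>\<^sub>0) $$ (p, p)"
        unfolding mat_mult_index_sum[OF \<rho>\<^sub>0c \<rho>\<^sub>0c p p] using p
        by (intro sum.cong refl) (simp add: M0 \<rho>\<^sub>0_idx[symmetric])
    qed
    hence "T 0 = 1" unfolding \<rho>\<^sub>0p rank_one_projection_trace[OF \<rho>\<^sub>0c \<rho>\<^sub>0r \<rho>\<^sub>0p] by (metis of_real_eq_1_iff)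
    finally show ?thesis unfolding T_def .
  qed

  \<comment> \<open>Splitting the path and its generator across the cut\<close>
  define Z where "Z = {..<b} \<times> {..<N}"
  define R where "R s i = (\<lambda>(x, m). M s (i * b + x) m)" for s i
  \<comment> \<open>The first \<open>k\<close> letters act on \<open>i\<close>, the remaining ones
    on \<open>x\<close>, and the column index \<open>m\<close> is left alone.\<close>
  define A where "A \<sigma> i j = pauli_operator (take k \<sigma>) $$ (i, j)" for \<sigma> i j
  define B where "B \<sigma> = (\<lambda>(x, m) (y, m'). pauli_operator (drop k \<sigma>) $$ (x, y) * of_bool (m' = (m :: nat)))" for \<sigma>
  have len: "a = 2 ^ length (take k \<sigma>)" "b = 2 ^ length (drop k \<sigma>)" "N = 2 ^ length \<sigma>"
    if "\<sigma> \<in> pauli_strings n" for \<sigma>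
    using that k unfolding pauli_strings_def a_def b_def N_def by auto
  have AB: "A \<sigma> i j * pauli_operator (drop k \<sigma>) $$ (x, y) = pauli_operator \<sigma> $$ (i * b + x, j * b + y)"
    if "\<sigma> \<in> pauli_strings n" "i < a" "j < a" "x < b" "y < b" for \<sigma> i j x y
    using pauli_operator_append_index[of i "take k \<sigma>" j x "drop k \<sigma>" y] that len[OF that(1)]
    unfolding A_def by simp
  have sum_Z: "(\<Sum>z\<in>Z. f z) = (\<Sum>x<b. \<Sum>m<N. f (x, m))" for f :: "nat \<times> nat \<Rightarrow> 'x :: comm_monoid_add"
    unfolding Z_def by (simp add: sum.cartesian_product)
  have R_deriv: "((\<lambda>s. R s i z) has_vector_derivative
      (\<Sum>\<sigma>\<in>pauli_strings n. complex_of_real (h \<sigma> t) * (- \<i> * (\<Sum>j<a. \<Sum>w\<in>Z. A \<sigma> i j * B \<sigma> z w * R t j w))))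
        (at t within {0..1})" if t: "t \<in> {0..1}" and i: "i < a" and z: "z \<in> Z" for t i z
  proof -
    obtain x m where zx: "z = (x, m)" "x < b" "m < N" using z unfolding Z_def by auto
    have p: "i * b + x < N" using mult_add_less_mult[OF i zx(2)] ab by simp
    have inner: "(\<Sum>j<a. \<Sum>w\<in>Z. A \<sigma> i j * B \<sigma> z w * R t j w)
        = (\<Sum>q<N. pauli_operator \<sigma> $$ (i * b + x, q) * M t q m)" if \<sigma>: "\<sigma> \<in> pauli_strings n" for \<sigma>
    proof -
      have "(\<Sum>j<a. \<Sum>w\<in>Z. A \<sigma> i j * B \<sigma> z w * R t j w)
          = (\<Sum>j<a. \<Sum>y<b. \<Sum>m'<N. (pauli_operator \<sigma> $$ (i * b + x, j * b + y) * M t (j * b + y) m') * of_bool (m' = m))"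
        unfolding sum_Z zx B_def R_def using AB[OF \<sigma> i _ zx(2)]
        by (intro sum.cong refl) (simp add: mult.assoc[symmetric])
      also have "\<dots> = (\<Sum>j<a. \<Sum>y<b. pauli_operator \<sigma> $$ (i * b + x, j * b + y) * M t (j * b + y) m)"
        using zx by (simp add: sum_mult_of_bool_eq)
      finally show ?thesis unfolding ab[symmetric] sum_lessThan_mult .
    qed
    have "- \<i> * (\<Sum>q<N. H t (i * b + x) q * M t q m)
        = (\<Sum>q<N. \<Sum>\<sigma>\<in>pauli_strings n. complex_of_real (h \<sigma> t) * (- \<i> * (pauli_operator \<sigma> $$ (i * b + x, q) * M t q m)))"
      unfolding sum_distrib_left using p
      by (intro sum.cong refl) (simp add: H_eq sum_distrib_left sum_distrib_right mult_ac)
    also have "\<dots> = (\<Sum>\<sigma>\<in>pauli_strings n. complex_of_real (h \<sigma> t) * (- \<i> * (\<Sum>j<a. \<Sum>w\<in>Z. A \<sigma> i j * B \<sigma> z w * R t j w)))"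
      by (subst sum.swap, intro sum.cong refl) (simp add: inner sum_distrib_left)
    finally show ?thesis using M_deriv[OF t p, of m] unfolding R_def zx by simp
  qed
  have norm_R: "(\<Sum>i<a. \<Sum>z\<in>Z. (cmod (R t i z))\<^sup>2) = 1" if "t \<in> {0..1}" for t
    using norm_M[OF that] unfolding ab[symmetric] sum_lessThan_mult[of _ a b] sum_Z R_def by simp
  have "\<exists>u e. (\<forall>t\<in>{0..1}. diagonalises a (\<lambda>i j. \<Sum>z\<in>Z. R t i z * cnj (R t j z)) (u t) (e t)) \<and>
    \<bar>(\<Sum>p<a. e 1 p * ln (e 1 p)) - (\<Sum>p<a. e 0 p * ln (e 0 p))\<bar>
      \<le> 2 * integral {0..1} (\<lambda>t. \<Sum>\<sigma>\<in>pauli_strings n. \<bar>h \<sigma> t\<bar>)"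
  proof (rule product_path_entropy_bound[OF _ finite_pauli_strings])
    show "finite Z" unfolding Z_def by simp
    fix \<sigma> assume \<sigma>: "\<sigma> \<in> pauli_strings n"
    show "continuous_on {0..1} (h \<sigma>)" by (rule smooth_on_unit_interval_continuous[OF smooth[OF \<sigma>]])
    show "hermitian_on {..<a} (A \<sigma>)"
      unfolding hermitian_on_def A_def len(1)[OF \<sigma>] using pauli_operator_hermitian by blast
    show "isometric_on {..<a} (A \<sigma>)"
      unfolding isometric_on_def A_def len(1)[OF \<sigma>] using pauli_operator_isometric by blast
    show "hermitian_on Z (B \<sigma>)"
      unfolding hermitian_on_def
    proof (intro ballI)
      fix z w assume "z \<in> Z" "w \<in> Z"
      then obtain x m y m' where zw: "z = (x, m)" "w = (y, m')" "x < b" "y < b" unfolding Z_def by auto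
      show "B \<sigma> z w = cnj (B \<sigma> w z)"
        using pauli_operator_hermitian[of x "drop k \<sigma>" y] zw(3,4) unfolding B_def zw(1,2) len(2)[OF \<sigma>] by simp
    qed
    show "isometric_on Z (B \<sigma>)"
      unfolding isometric_on_def
    proof (intro ballI)
      fix w w' assume "w \<in> Z" "w' \<in> Z"
      then obtain y m y' m' where ww: "w = (y, m)" "w' = (y', m')" "y < b" "y' < b" "m < N" "m' < N"
        unfolding Z_def by auto
      have "(\<Sum>z\<in>Z. cnj (B \<sigma> z w) * B \<sigma> z w')
          = (\<Sum>x<b. \<Sum>l<N. (cnj (pauli_operator (drop k \<sigma>) $$ (x, y)) * pauli_operator (drop k \<sigma>) $$ (x, y') * of_bool (m' = l)) * of_bool (m = l))"
        unfolding sum_Z B_def ww by (intro sum.cong refl) (simp add: of_bool_def)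
      also have "\<dots> = (\<Sum>x<b. cnj (pauli_operator (drop k \<sigma>) $$ (x, y)) * pauli_operator (drop k \<sigma>) $$ (x, y')) * of_bool (m' = m)"
        using ww by (simp add: sum_mult_of_bool_eq' sum_distrib_right)
      also have "\<dots> = of_bool (w = w')"
        using pauli_operator_isometric[of y "drop k \<sigma>" y'] ww unfolding len(2)[OF \<sigma>, symmetric] by auto
      finally show "(\<Sum>z\<in>Z. cnj (B \<sigma> z w) * B \<sigma> z w') = of_bool (w = w')" .
    qed
  qed (fact R_deriv norm_R)+
  then obtain u e where diag: "\<And>t. t \<in> {0..1} \<Longrightarrow> diagonalises a (\<lambda>i j. \<Sum>z\<in>Z. R t i z * cnj (R t j z)) (u t) (e t)"
    and bound: "\<bar>(\<Sum>p<a. e 1 p * ln (e 1 p)) - (\<Sum>p<a. e 0 p * ln (e 0 p))\<bar> \<le> 2 * path_cost n h"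
    unfolding path_cost_def by blast

  \<comment> \<open>Entropies at the two ends of the path\<close>
  have entropy: "entanglement_entropy n k \<rho> = - (\<Sum>p<a. e t p * ln (e t p))"
    if t: "t \<in> {0..1}" and \<rho>: "\<And>p q. p < N \<Longrightarrow> q < N \<Longrightarrow> \<rho> $$ (p, q) = (\<Sum>m<N. M t p m * cnj (M t q m))" for t \<rho>
    unfolding a_def
  proof (rule entropy_of_gram[where M = "M t" and N = N, OF k])
    show "\<rho> $$ (p, q) = (\<Sum>m<N. M t p m * cnj (M t q m))" if "p < 2 ^ n" "q < 2 ^ n" for p q
      using \<rho> that unfolding N_def by blast
    show "diagonalises (2 ^ k) (\<lambda>i j. \<Sum>(x, m)\<in>{..<2 ^ (n - k)} \<times> {..<N}.
        M t (i * 2 ^ (n - k) + x) m * cnj (M t (j * 2 ^ (n - k) + x) m)) (u t) (e t)"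
      using diag[OF t] unfolding a_def b_def[symmetric] Z_def[symmetric] R_def by (simp add: case_prod_unfold)
  qed
  have "\<rho>\<^sub>0 $$ (p, q) = (\<Sum>m<N. M 0 p m * cnj (M 0 q m))" if "p < N" "q < N" for p q
  proof -
    have "\<rho>\<^sub>0 $$ (p, q) = (\<rho>\<^sub>0 * \<rho>\<^sub>0) $$ (p, q)" unfolding \<rho>\<^sub>0p ..
    also have "\<dots> = (\<Sum>m<N. M 0 p m * cnj (M 0 q m))"
      unfolding mat_mult_index_sum[OF \<rho>\<^sub>0c \<rho>\<^sub>0c that] using that
      by (intro sum.cong refl) (simp add: M0 \<rho>\<^sub>0_idx[symmetric])
    finally show ?thesis .
  qed
  hence S0: "entanglement_entropy n k \<rho>\<^sub>0 = - (\<Sum>p<a. e 0 p * ln (e 0 p))" by (intro entropy) auto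
  have "\<rho>\<^sub>1 $$ (p, q) = (\<Sum>m<N. M 1 p m * cnj (M 1 q m))" if pq: "p < N" "q < N" for p q
  proof -
    have U1: "U 1 \<in> carrier_mat N N" "mat_adjoint (U 1) \<in> carrier_mat N N"
      using Uc[of 1] by (auto intro: adjoint_carrier)
    have W: "U 1 * \<rho>\<^sub>0 \<in> carrier_mat N N" "mat_adjoint (U 1 * \<rho>\<^sub>0) \<in> carrier_mat N N"
      using U1 \<rho>\<^sub>0c by (auto intro: adjoint_carrier)
    have "(U 1 * \<rho>\<^sub>0) * mat_adjoint (U 1 * \<rho>\<^sub>0) = (U 1 * \<rho>\<^sub>0) * (\<rho>\<^sub>0 * mat_adjoint (U 1))"
      unfolding adjoint_mult[OF U1(1) \<rho>\<^sub>0c] \<rho>\<^sub>0h ..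
    also have "\<dots> = U 1 * (\<rho>\<^sub>0 * \<rho>\<^sub>0) * mat_adjoint (U 1)"
      using U1 \<rho>\<^sub>0c by (simp add: assoc_mult_mat[of _ N N _ N _ N])
    finally have \<rho>\<^sub>1': "\<rho>\<^sub>1 = (U 1 * \<rho>\<^sub>0) * mat_adjoint (U 1 * \<rho>\<^sub>0)" unfolding \<rho>\<^sub>0p \<rho>\<^sub>1 ..
    have W_idx: "(U 1 * \<rho>\<^sub>0) $$ (p, m) = M 1 p m" if "p < N" "m < N" for p m
      unfolding M_def by (rule mat_mult_index_sum[OF U1(1) \<rho>\<^sub>0c that])
    have "mat_adjoint (U 1 * \<rho>\<^sub>0) $$ (m, q) = cnj (M 1 q m)" if m: "m < N" for m
      using adjoint_index[of m "U 1 * \<rho>\<^sub>0" q] W(1) m pq(2) W_idx[OF pq(2) m] by (metis carrier_matD)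
    thus ?thesis unfolding \<rho>\<^sub>1' mat_mult_index_sum[OF W pq] using W_idx pq by (intro sum.cong refl) simp
  qed
  hence "entanglement_entropy n k \<rho>\<^sub>1 = - (\<Sum>p<a. e 1 p * ln (e 1 p))" by (intro entropy) auto
  thus ?thesis using bound S0 by simp
qed

theorem theorem2:
  fixes l :: nat
  assumes "l \<ge> 2"
  shows "\<exists>c::real. c > 0 \<and> (\<forall>n::nat. n \<ge> 2 \<longrightarrow>
    (\<forall>\<rho>\<^sub>0 \<rho>\<^sub>1. pure_state n \<rho>\<^sub>0 \<longrightarrow> pure_state n \<rho>\<^sub>1 \<longrightarrow>
      nielsen_complexity l n \<rho>\<^sub>0 \<rho>\<^sub>1 \<ge>
        ereal (c / (real n - 1) *
          (\<Sum>k = 1..n - 1. \<bar>entanglement_entropy n k \<rho>\<^sub>1 - entanglement_entropy n k \<rho>\<^sub>0\<bar>))))"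
proof (intro exI[of _ "1 / 2"] conjI allI impI)
  fix n :: nat and \<rho>\<^sub>0 \<rho>\<^sub>1
  assume n: "2 \<le> n" and pure: "pure_state n \<rho>\<^sub>0"
  let ?\<Delta> = "\<lambda>k. \<bar>entanglement_entropy n k \<rho>\<^sub>1 - entanglement_entropy n k \<rho>\<^sub>0\<bar>"
  have "(1 / 2) / (real n - 1) * (\<Sum>k = 1..n - 1. ?\<Delta> k) \<le> path_cost n h"
    if h: "admissible_path l n \<rho>\<^sub>0 \<rho>\<^sub>1 h" for h
  proof -
    have "?\<Delta> k \<le> 2 * path_cost n h" if "k \<in> {1..n - 1}" for k
      using h that n unfolding admissible_path_def
      by (elim conjE exE) (rule entropy_change_le_path_cost[OF _ pure], auto)
    hence "(\<Sum>k = 1..n - 1. ?\<Delta> k) \<le> (\<Sum>k = 1..n - 1. 2 * path_cost n h)" by (rule sum_mono)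
    \<comment> \<open>There are \<open>n - 1\<close> cuts, each with the bound
      \<open>2 * path_cost n h\<close>; the factor 2 determines the constant 1/2.\<close>
    also have "\<dots> = (real n - 1) * (2 * path_cost n h)" using n by (simp add: of_nat_diff)
    finally show ?thesis using n by (simp add: field_simps)
  qed
  \<comment> \<open>A bound valid for every admissible path passes to the infimum; without such a
    path the infimum is infinite.\<close>
  thus "ereal ((1 / 2) / (real n - 1) * (\<Sum>k = 1..n - 1. ?\<Delta> k)) \<le> nielsen_complexity l n \<rho>\<^sub>0 \<rho>\<^sub>1"
    unfolding nielsen_complexity_def by (intro INF_greatest) simp
qed simp

end
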